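(* Let $n\ge5$ and let $P^n_\omega$ be an edge-weighted path with vertices $x_1,\dots,x_n$, edges $e_j=\{x_j,x_{j+1}\}$ and weights $\omega_j=\omega(e_j)$, whose edge ideal $I=I(P^n_\omega)\subseteq S=\mathbb{K}[x_1,\dots,x_n]$ is integrally closed. Suppose that for some $i\in[n-3]$ we have $\omega_i>\omega_{i+2}$ and $\omega_j=1$ for all $j\ne i,i+2$. Then for every $t\ge2$: (1) if $\omega_{i+2}=1$, then $\operatorname{depth}(S/I^t)\ge\lceil\frac{n-1}{3}\rceil$ when $t=2$, $i\equiv1\pmod 3$ and $n\equiv2\pmod3$, and $\operatorname{depth}(S/I^t)\ge\max\{\lceil\frac{n-t}{3}\rceil,1\}$ otherwise; (2) if $\omega_{i+2}>1$, then $\operatorname{depth}(S/I^t)\ge\max\{\lceil\frac{n-t}{3}\rceil,2\}$.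
   Context: $\mathbb{K}$ is a field. For a simple graph $G$ with weight function $\omega:E(G)\to\mathbb{Z}_{>0}$, $I(G_\omega)=(x_i^{\omega(e)}x_j^{\omega(e)}\mid e=\{x_i,x_j\}\in E(G))$. An ideal is integrally closed if it equals its integral closure. *)

theory Defs
  imports Complex_Main "HOL-Library.Poly_Mapping" "HOL-Library.Extended_Nat"
begin

type_synonym 'a mpoly = "(nat \<Rightarrow>\<^sub>0 nat) \<Rightarrow>\<^sub>0 'a"

definition PR :: "nat \<Rightarrow> 'a::field mpoly set" where
  "PR n = {p. \<forall>m\<in>Poly_Mapping.keys p. Poly_Mapping.keys m \<subseteq> {1..n}}"

definition Var :: "nat \<Rightarrow> 'a::field mpoly" where
  "Var i = Poly_Mapping.single (Poly_Mapping.single i 1) 1"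

inductive_set ideal_gen :: "nat \<Rightarrow> 'a::field mpoly set \<Rightarrow> 'a mpoly set"
  for n :: nat and G :: "'a mpoly set" where
  zero: "0 \<in> ideal_gen n G"
| gen: "g \<in> G \<Longrightarrow> g \<in> ideal_gen n G"
| add: "a \<in> ideal_gen n G \<Longrightarrow> b \<in> ideal_gen n G \<Longrightarrow> a + b \<in> ideal_gen n G"
| smult: "r \<in> PR n \<Longrightarrow> a \<in> ideal_gen n G \<Longrightarrow> r * a \<in> ideal_gen n G"

fun ideal_pow :: "nat \<Rightarrow> 'a::field mpoly set \<Rightarrow> nat \<Rightarrow> 'a mpoly set" where
  "ideal_pow n I 0 = PR n"
| "ideal_pow n I (Suc t) = ideal_gen n {a * b | a b. a \<in> ideal_pow n I t \<and> b \<in> I}"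

definition integral_over_ideal :: "nat \<Rightarrow> 'a::field mpoly set \<Rightarrow> 'a mpoly \<Rightarrow> bool" where
  "integral_over_ideal n I f \<longleftrightarrow> (\<exists>k\<ge>1. \<exists>a :: nat \<Rightarrow> 'a mpoly.
      (\<forall>j\<in>{1..k}. a j \<in> ideal_pow n I j) \<and>
      f ^ k + (\<Sum>j=1..k. a j * f ^ (k - j)) = 0)"

definition integral_closure :: "nat \<Rightarrow> 'a::field mpoly set \<Rightarrow> 'a mpoly set" where
  "integral_closure n I = {f \<in> PR n. integral_over_ideal n I f}"

definition integrally_closed :: "nat \<Rightarrow> 'a::field mpoly set \<Rightarrow> bool" where
  "integrally_closed n I \<longleftrightarrow> integral_closure n I = I"

definition max_ideal :: "nat \<Rightarrow> 'a::field mpoly set" where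
  "max_ideal n = ideal_gen n (Var ` {1..n})"

definition regular_seq :: "nat \<Rightarrow> 'a::field mpoly set \<Rightarrow> 'a mpoly list \<Rightarrow> bool" where
  "regular_seq n J fs \<longleftrightarrow>
     (\<forall>i<length fs. fs ! i \<in> max_ideal n \<and>
        (\<forall>g\<in>PR n. fs ! i * g \<in> ideal_gen n (J \<union> set (take i fs))
                   \<longrightarrow> g \<in> ideal_gen n (J \<union> set (take i fs)))) \<and>
     ideal_gen n (J \<union> set fs) \<noteq> PR n"

definition depth :: "nat \<Rightarrow> 'a::field mpoly set \<Rightarrow> enat" where
  "depth n J = (SUP fs \<in> {fs. regular_seq n J fs}. enat (length fs))"

definition path_edge_ideal :: "nat \<Rightarrow> (nat \<Rightarrow> nat) \<Rightarrow> 'a::field mpoly set" where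
  "path_edge_ideal n w = ideal_gen n
     ((\<lambda>j. Var j ^ w j * Var (Suc j) ^ w j) ` {1..n-1})"

end

theory Submission
  imports Defs "HOL-Library.Multiset"
begin

text \<open>
  The elementary symmetric polynomials serve as universal parameters: \<open>e\<^sub>1, \<dots>, e\<^sub>r\<close> is regular on
  every polynomial ring in at least \<open>r\<close> of the variables. Regularity of a fixed sequence passes through
  the exact sequence \<open>0 \<rightarrow> S/(J : m) \<rightarrow> S/J \<rightarrow> S/(J + m) \<rightarrow> 0\<close>, so \<open>S/J\<close> has depth at least
  \<open>r\<close> as soon as a monomial ideal \<open>J\<close> can be split repeatedly by monomials until only
  ideals generated by at most \<open>n - r\<close> variables remain; no general theory of depth is needed.

  For a leaf edge \<open>zy\<close> of weight 1 one has \<open>I\<^sup>t : zy = I\<^bsup>t-1\<^esup>\<close>. Writing \<open>F(n, t)\<close> for the depth bound,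
  splitting at the last two unit edges of the path gives
  \<open>F(n, t) \<ge> min {F(n, t-1), 1 + F(n-2, t), F(n-1, t-1), 1 + F(n-3, t)}\<close>, and likewise at the other end.
  This shrinks the path to the heavy edges and at most one vertex on each side. If both
  \<open>\<omega>\<^sub>i\<close> and \<open>\<omega>\<^bsub>i+2\<^esub>\<close> exceed 1, the unit edge \<open>e\<close> between the heavy ones also satisfies
  \<open>I\<^sup>t : e = I\<^bsup>t-1\<^esup>\<close>, because \<open>e\<^sup>2\<close> divides the product of the two heavy edges.
\<close>

section \<open>Polynomials as sums of monomial terms\<close>

abbreviation lookup where "lookup \<equiv> Poly_Mapping.lookup"
abbreviation keys where "keys \<equiv> Poly_Mapping.keys"
abbreviation single where "single \<equiv> Poly_Mapping.single"

type_synonym mono = "nat \<Rightarrow>\<^sub>0 nat"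

lemma poly_expand: "p = (\<Sum>u\<in>keys p. single u (lookup p u))"
  by (rule poly_mapping_eqI) (auto simp: lookup_sum lookup_single when_def in_keys_iff)

text \<open>Multiplication by a monomial shifts exponents injectively, so no terms cancel. This
  reduces colons by monomials to statements about supports.\<close>

lemma keys_monom_mult:
  fixes g :: "'a::field mpoly"
  shows "keys (single m 1 * g) = (+) m ` keys g"
proof -
  have "lookup (single m 1 * g) (m + u) = lookup g u" for u
  proof -
    have "single m 1 * g = single m 1 * (\<Sum>v\<in>keys g. single v (lookup g v))"
      using poly_expand[of g] by simp
    also have "\<dots> = (\<Sum>v\<in>keys g. single (m + v) (lookup g v))"
      by (simp add: sum_distrib_left mult_single)
    finally have "lookup (single m 1 * g) (m + u)
        = (\<Sum>v\<in>keys g. lookup g v when m + v = m + u)"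
      by (simp add: lookup_sum lookup_single)
    also have "\<dots> = lookup g u"
      by (auto simp: when_def in_keys_iff)
    finally show ?thesis .
  qed
  moreover have "keys (single m 1 * g) \<subseteq> (+) m ` keys g"
    using keys_mult[of "single m 1" g] by (auto split: if_splits)
  ultimately show ?thesis by (auto simp: in_keys_iff)
qed

subsection \<open>Ideals of the polynomial ring\<close>

lemma PR_0 [simp]: "0 \<in> PR n" by (simp add: PR_def)

lemma PR_1 [simp]: "1 \<in> PR n" by (simp add: PR_def)

lemma PR_add [simp]: "p \<in> PR n \<Longrightarrow> q \<in> PR n \<Longrightarrow> p + q \<in> PR n"
  unfolding PR_def using Poly_Mapping.keys_add[of p q] by blast

lemma PR_uminus [simp]: "p \<in> PR n \<Longrightarrow> - p \<in> PR n"
  by (simp add: PR_def in_keys_iff)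

lemma PR_diff [simp]: "p \<in> PR n \<Longrightarrow> q \<in> PR n \<Longrightarrow> p - q \<in> PR n"
  using PR_add[of p n "- q"] by simp

lemma PR_mult [simp]:
  assumes "p \<in> PR n" "q \<in> PR n"
  shows "p * q \<in> PR n"
  unfolding PR_def
proof (intro CollectI ballI)
  fix m assume "m \<in> keys (p * q)"
  then obtain u v where "m = u + v" "u \<in> keys p" "v \<in> keys q" using keys_mult[of p q] by blast
  then show "keys m \<subseteq> {1..n}"
    using assms Poly_Mapping.keys_add[of u v] unfolding PR_def by blast
qed

lemma PR_sum: "(\<And>x. x \<in> A \<Longrightarrow> f x \<in> PR n) \<Longrightarrow> sum f A \<in> PR n"
  by (induction A rule: infinite_finite_induct) auto

lemma PR_single [simp]: "keys m \<subseteq> {1..n} \<Longrightarrow> single m c \<in> PR n"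
  by (simp add: PR_def)

definition is_ideal :: "nat \<Rightarrow> 'a::field mpoly set \<Rightarrow> bool" where
  "is_ideal n J \<longleftrightarrow> J \<subseteq> PR n \<and> 0 \<in> J \<and> (\<forall>a\<in>J. \<forall>b\<in>J. a + b \<in> J) \<and> (\<forall>r\<in>PR n. \<forall>a\<in>J. r * a \<in> J)"

lemma ideal_PR: "is_ideal n J \<Longrightarrow> a \<in> J \<Longrightarrow> a \<in> PR n"
  and ideal_0: "is_ideal n J \<Longrightarrow> 0 \<in> J"
  and ideal_add: "is_ideal n J \<Longrightarrow> a \<in> J \<Longrightarrow> b \<in> J \<Longrightarrow> a + b \<in> J"
  and ideal_mult: "is_ideal n J \<Longrightarrow> r \<in> PR n \<Longrightarrow> a \<in> J \<Longrightarrow> r * a \<in> J"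
  by (auto simp: is_ideal_def)

lemma ideal_uminus: "is_ideal n J \<Longrightarrow> a \<in> J \<Longrightarrow> - a \<in> J"
  using ideal_mult[of n J "- 1" a] by simp

lemma ideal_diff: "is_ideal n J \<Longrightarrow> a \<in> J \<Longrightarrow> b \<in> J \<Longrightarrow> a - b \<in> J"
  using ideal_add[of n J a "- b"] ideal_uminus[of n J b] by simp

lemma ideal_sum: "is_ideal n J \<Longrightarrow> (\<And>x. x \<in> A \<Longrightarrow> f x \<in> J) \<Longrightarrow> sum f A \<in> J"
  by (induction A rule: infinite_finite_induct) (auto intro: ideal_0 ideal_add)

lemma is_ideal_gen: "G \<subseteq> PR n \<Longrightarrow> is_ideal n (ideal_gen n G)"
proof -
  assume G: "G \<subseteq> PR n"
  have "a \<in> ideal_gen n G \<Longrightarrow> a \<in> PR n" for a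
    by (induction rule: ideal_gen.induct) (use G in auto)
  then show ?thesis
    by (auto simp: is_ideal_def intro: ideal_gen.intros)
qed

lemma ideal_gen_least: "is_ideal n J \<Longrightarrow> G \<subseteq> J \<Longrightarrow> ideal_gen n G \<subseteq> J"
proof
  fix a assume J: "is_ideal n J" "G \<subseteq> J" and "a \<in> ideal_gen n G"
  from this(3) show "a \<in> J"
    by (induction rule: ideal_gen.induct) (use J in \<open>auto intro: ideal_0 ideal_add ideal_mult\<close>)
qed

definition ext :: "nat \<Rightarrow> 'a::field mpoly set \<Rightarrow> 'a mpoly \<Rightarrow> 'a mpoly set" where
  "ext n J f = {a + f * b | a b. a \<in> J \<and> b \<in> PR n}"

definition colon :: "nat \<Rightarrow> 'a::field mpoly set \<Rightarrow> 'a mpoly \<Rightarrow> 'a mpoly set" where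
  "colon n J f = {g \<in> PR n. f * g \<in> J}"

lemma is_ideal_ext: "is_ideal n J \<Longrightarrow> f \<in> PR n \<Longrightarrow> is_ideal n (ext n J f)"
proof -
  assume J: "is_ideal n J" and f: "f \<in> PR n"
  have "a + f * b + (a' + f * b') \<in> ext n J f"
    if "a \<in> J" "b \<in> PR n" "a' \<in> J" "b' \<in> PR n" for a b a' b'
  proof -
    have "a + f * b + (a' + f * b') = (a + a') + f * (b + b')" by (simp add: algebra_simps)
    then show ?thesis unfolding ext_def using that ideal_add[OF J] PR_add by blast
  qed
  moreover have "r * (a + f * b) \<in> ext n J f" if "r \<in> PR n" "a \<in> J" "b \<in> PR n" for r a b
  proof -
    have "r * (a + f * b) = r * a + f * (r * b)" by (simp add: algebra_simps)
    then show ?thesis unfolding ext_def using that ideal_mult[OF J] PR_mult by blast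
  qed
  moreover have "0 \<in> ext n J f"
    unfolding ext_def using ideal_0[OF J] by (force intro: exI[of _ 0])
  moreover have "ext n J f \<subseteq> PR n"
    unfolding ext_def using ideal_PR[OF J] f by auto
  ultimately show ?thesis unfolding is_ideal_def by (auto simp: ext_def)
qed

lemma ext_sub: "J \<subseteq> ext n J f"
proof
  fix a assume "a \<in> J"
  then have "a = a + f * 0 \<and> a \<in> J \<and> (0 :: 'a mpoly) \<in> PR n" by simp
  then show "a \<in> ext n J f" unfolding ext_def by blast
qed

lemma ext_mem: "is_ideal n J \<Longrightarrow> b \<in> PR n \<Longrightarrow> f * b \<in> ext n J f"
  unfolding ext_def using ideal_0 by force

lemma ext_eq_gen: "is_ideal n J \<Longrightarrow> f \<in> PR n \<Longrightarrow> ext n J f = ideal_gen n (J \<union> {f})"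
proof (rule antisym)
  assume J: "is_ideal n J" and f: "f \<in> PR n"
  have "J \<union> {f} \<subseteq> PR n" using J f ideal_PR by auto
  note I = is_ideal_gen[OF this]
  show "ext n J f \<subseteq> ideal_gen n (J \<union> {f})"
  proof
    fix x assume "x \<in> ext n J f"
    then obtain a b where "x = a + b * f" "a \<in> J" "b \<in> PR n"
      by (auto simp: ext_def mult.commute)
    then show "x \<in> ideal_gen n (J \<union> {f})" by (auto intro: ideal_gen.intros)
  qed
  have "f \<in> ext n J f" using ext_mem[OF J, of 1 f] by simp
  then show "ideal_gen n (J \<union> {f}) \<subseteq> ext n J f"
    by (intro ideal_gen_least is_ideal_ext J f) (use ext_sub in auto)
qed

lemma ext_commute: "ext n (ext n J f) g = ext n (ext n J g) f"
proof -
  have "ext n (ext n J f) g \<subseteq> ext n (ext n J g) f" for f g :: "'a mpoly"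
  proof
    fix x assume "x \<in> ext n (ext n J f) g"
    then obtain a b c where "x = a + f * b + g * c" and abc: "a \<in> J" "b \<in> PR n" "c \<in> PR n"
      by (auto simp: ext_def)
    then have "x = (a + g * c) + f * b" by simp
    then show "x \<in> ext n (ext n J g) f" unfolding ext_def using abc by blast
  qed
  then show ?thesis by blast
qed

section \<open>Weakly regular sequences\<close>

definition nzd :: "nat \<Rightarrow> 'a::field mpoly set \<Rightarrow> 'a mpoly \<Rightarrow> bool" where
  "nzd n J f \<longleftrightarrow> (\<forall>g\<in>PR n. f * g \<in> J \<longrightarrow> g \<in> J)"

lemma nzdD: "nzd n J f \<Longrightarrow> g \<in> PR n \<Longrightarrow> f * g \<in> J \<Longrightarrow> g \<in> J"
  by (simp add: nzd_def)

text \<open>Properness of the last quotient is left out, so that the unit ideal, which arises as a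
  colon, satisfies the condition. It is restored when \<open>regular_seq\<close> is
  established.\<close>

fun wreg :: "nat \<Rightarrow> 'a::field mpoly set \<Rightarrow> 'a mpoly list \<Rightarrow> bool" where
  "wreg n J [] \<longleftrightarrow> True"
| "wreg n J (f # fs) \<longleftrightarrow> nzd n J f \<and> wreg n (ext n J f) fs"

lemma wreg_append: "wreg n J (fs @ gs) \<longleftrightarrow> wreg n J fs \<and> wreg n (foldl (ext n) J fs) gs"
  by (induction fs arbitrary: J) auto

lemma ext_PR: "f \<in> PR n \<Longrightarrow> ext n (PR n) f = PR n"
  using ext_sub[of "PR n" n f] by (auto simp: ext_def)

lemma wreg_PR: "set fs \<subseteq> PR n \<Longrightarrow> wreg n (PR n) fs"
  by (induction fs) (auto simp: nzd_def ext_PR)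

text \<open>The exact sequence \<open>0 \<rightarrow> S/(J : m) \<rightarrow> S/J \<rightarrow> S/(J + m) \<rightarrow> 0\<close> stays exact after reduction
  modulo an element that is regular on both ends.\<close>

lemma wreg_split:
  assumes "is_ideal n J" "m \<in> PR n" "set fs \<subseteq> PR n"
    and "wreg n (colon n J m) fs" "wreg n (ext n J m) fs"
  shows "wreg n J fs"
  using assms
proof (induction fs arbitrary: J)
  case Nil
  then show ?case by simp
next
  case (Cons f fs)
  note J = Cons.prems(1) and m = Cons.prems(2)
  have f: "f \<in> PR n" and fs: "set fs \<subseteq> PR n" using Cons.prems by auto
  have nc: "nzd n (colon n J m) f" and ne: "nzd n (ext n J m) f"
    using Cons.prems by auto
  have nz: "nzd n J f"
    unfolding nzd_def
  proof (intro ballI impI)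
    fix g assume g: "g \<in> PR n" "f * g \<in> J"
    \<comment> \<open>Regularity on the quotient by \<open>m\<close> puts \<open>g\<close> into J +
      (m); regularity on the colon then disposes of the multiple of \<open>m\<close>.\<close>
    then have "g \<in> ext n J m" using nzdD[OF ne] ext_sub[of J n m] by blast
    then obtain a b where ab: "g = a + m * b" "a \<in> J" "b \<in> PR n" by (auto simp: ext_def)
    have "m * (f * b) = f * g - f * a" using ab by (simp add: algebra_simps)
    also have "\<dots> \<in> J" using g ab f J by (simp add: ideal_diff ideal_mult)
    finally have "f * b \<in> colon n J m" using f ab by (simp add: colon_def)
    then have "b \<in> colon n J m" using nzdD[OF nc] ab by blast
    then show "g \<in> J" using ab J by (simp add: colon_def ideal_add)
  qed
  \<comment> \<open>Reduction modulo \<open>f\<close> commutes with the colon, so the induction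
    hypothesis applies to \<open>ext n J f\<close>. The inclusion from left to right uses that
    \<open>f\<close> is regular modulo \<open>ext n J m\<close>.\<close>
  have "colon n (ext n J f) m = ext n (colon n J m) f"
  proof (rule antisym)
    show "ext n (colon n J m) f \<subseteq> colon n (ext n J f) m"
    proof
      fix x assume "x \<in> ext n (colon n J m) f"
      then obtain a b where x: "x = a + f * b" "a \<in> PR n" "m * a \<in> J" "b \<in> PR n"
        by (auto simp: ext_def colon_def)
      have "m * x = m * a + f * (m * b)" using x by (simp add: algebra_simps)
      then have "m * x \<in> ext n J f" unfolding ext_def using x PR_mult[OF m x(4)] by blast
      then show "x \<in> colon n (ext n J f) m" using x f by (simp add: colon_def)
    qed
    show "colon n (ext n J f) m \<subseteq> ext n (colon n J m) f"
    proof
      fix g assume "g \<in> colon n (ext n J f) m"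
      then obtain a b where g: "g \<in> PR n" "m * g = a + f * b" "a \<in> J" "b \<in> PR n"
        by (auto simp: colon_def ext_def)
      have "f * b = m * g - a" using g by (simp add: algebra_simps)
      also have "\<dots> \<in> ext n J m"
        using ideal_diff[OF is_ideal_ext[OF J m], of "m * g" a] g ext_mem[OF J] ext_sub[of J n m]
        by blast
      finally have "b \<in> ext n J m" using nzdD[OF ne] g by blast
      then obtain a' c where c: "b = a' + m * c" "a' \<in> J" "c \<in> PR n" by (auto simp: ext_def)
      have "m * (g - f * c) = a + f * a'" using g c by (simp add: algebra_simps)
      also have "\<dots> \<in> J" using g c J f by (simp add: ideal_add ideal_mult)
      finally have "g - f * c \<in> colon n J m" using g c f by (simp add: colon_def)
      moreover have "g = (g - f * c) + f * c" by simp
      ultimately show "g \<in> ext n (colon n J m) f" unfolding ext_def using c by blast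
    qed
  qed
  then have "wreg n (ext n J f) fs"
    using Cons.IH[OF is_ideal_ext[OF J f] m fs] Cons.prems ext_commute[of n J f m] by simp
  with nz show ?case by simp
qed

subsection \<open>Homogeneous components\<close>

definition deg :: "nat \<Rightarrow> mono \<Rightarrow> nat" where
  "deg n m = (\<Sum>i\<in>{1..n}. lookup m i)"

lemma deg_add: "deg n (a + b) = deg n a + deg n b"
  by (simp add: deg_def lookup_add sum.distrib)

definition hc :: "nat \<Rightarrow> nat \<Rightarrow> 'a::field mpoly \<Rightarrow> 'a mpoly" where
  "hc n d p = Poly_Mapping.mapp (\<lambda>m c. if deg n m = d then c else 0) p"

lemma lookup_hc: "lookup (hc n d p) m = (if deg n m = d then lookup p m else 0)"
  by (auto simp: hc_def lookup_mapp when_def in_keys_iff)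

lemma keys_hc: "keys (hc n d p) \<subseteq> keys p"
  by (auto simp: in_keys_iff lookup_hc split: if_splits)

lemma hc_PR: "p \<in> PR n \<Longrightarrow> hc n d p \<in> PR n"
  unfolding PR_def using keys_hc[of n d p] by blast

lemma hc_add: "hc n d (p + q) = hc n d p + hc n d q"
  by (rule poly_mapping_eqI) (simp add: lookup_hc lookup_add)

lemma hc_diff: "hc n d (p - q) = hc n d p - hc n d q"
  by (rule poly_mapping_eqI) (simp add: lookup_hc lookup_minus)

lemma hc_sum: "p = (\<Sum>d\<in>deg n ` keys p. hc n d p)"
  by (rule poly_mapping_eqI) (auto simp: lookup_sum lookup_hc in_keys_iff)

definition homog :: "nat \<Rightarrow> nat \<Rightarrow> 'a::field mpoly \<Rightarrow> bool" where
  "homog n c f \<longleftrightarrow> (\<forall>m\<in>keys f. deg n m = c)"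

lemma hc_eq_0: "(\<And>m. m \<in> keys p \<Longrightarrow> deg n m \<noteq> d) \<Longrightarrow> hc n d p = 0"
  by (rule poly_mapping_eqI) (auto simp: lookup_hc in_keys_iff)

lemma hc_mult_low: "homog n c f \<Longrightarrow> d < c \<Longrightarrow> hc n d (f * b) = 0"
proof (rule hc_eq_0)
  fix m assume f: "homog n c f" and d: "d < c" and "m \<in> keys (f * b)"
  then obtain u v where "m = u + v" "u \<in> keys f" using keys_mult[of f b] by blast
  then show "deg n m \<noteq> d" using f d by (auto simp: homog_def deg_add)
qed

lemma hc_mult:
  assumes f: "homog n c f"
  shows "hc n (c + d) (f * b) = f * hc n d b"
proof -
  have "hc n (c + d) (f * (b - hc n d b)) = 0"
  proof (rule hc_eq_0)
    fix m assume "m \<in> keys (f * (b - hc n d b))"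
    then obtain u v where "m = u + v" "u \<in> keys f" "v \<in> keys (b - hc n d b)"
      using keys_mult[of f "b - hc n d b"] by blast
    then show "deg n m \<noteq> c + d"
      using f by (auto simp: homog_def deg_add in_keys_iff lookup_minus lookup_hc)
  qed
  moreover have "hc n (c + d) (f * hc n d b) = f * hc n d b"
  proof (rule poly_mapping_eqI)
    fix m
    have "deg n m = c + d" if mk: "m \<in> keys (f * hc n d b)"
    proof -
      obtain u v where "m = u + v" "u \<in> keys f" "v \<in> keys (hc n d b)"
        using keys_mult[of f "hc n d b"] mk by blast
      then show ?thesis
        using f by (auto simp: homog_def deg_add in_keys_iff lookup_hc split: if_splits)
    qed
    then show "lookup (hc n (c + d) (f * hc n d b)) m = lookup (f * hc n d b) m"
      by (auto simp: lookup_hc in_keys_iff)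
  qed
  moreover have "f * b = f * (b - hc n d b) + f * hc n d b" by (simp add: algebra_simps)
  ultimately show ?thesis by (simp add: hc_add)
qed

definition hom_ideal :: "nat \<Rightarrow> 'a::field mpoly set \<Rightarrow> bool" where
  "hom_ideal n J \<longleftrightarrow> is_ideal n J \<and> (\<forall>p\<in>J. \<forall>d. hc n d p \<in> J)"

lemma hom_ideal_ext:
  assumes J: "hom_ideal n J" and f: "homog n c f" "f \<in> PR n"
  shows "hom_ideal n (ext n J f)"
proof -
  have id: "is_ideal n J" using J by (simp add: hom_ideal_def)
  have "hc n d (a + f * b) \<in> ext n J f" if a: "a \<in> J" and b: "b \<in> PR n" for a b d
  proof -
    have ha: "hc n d a \<in> J" using J a by (simp add: hom_ideal_def)
    show ?thesis
    proof (cases "d < c")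
      case True
      then show ?thesis using ha ext_sub[of J n f] by (auto simp: hc_add hc_mult_low[OF f(1)])
    next
      case False
      then have "hc n d (a + f * b) = hc n d a + f * hc n (d - c) b"
        using hc_mult[OF f(1), of "d - c" b] by (simp add: hc_add)
      then show ?thesis unfolding ext_def using ha hc_PR[OF b] by blast
    qed
  qed
  then show ?thesis
    using is_ideal_ext[OF id f(2)] by (auto simp: hom_ideal_def ext_def)
qed

lemma Var_power: "Var i ^ k = (single (single i k) 1 :: 'a::field mpoly)"
  by (induction k) (simp_all add: Var_def mult_single flip: single_add)

lemma keys_single_sub: "keys (single i k) \<subseteq> {i}"
  by (auto simp: in_keys_iff lookup_single when_def split: if_splits)

lemma Var_PR: "i \<in> {1..n} \<Longrightarrow> Var i \<in> PR n"
  unfolding Var_def by (rule PR_single) (use keys_single_sub[of i "1::nat"] in auto)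

lemma deg_single: "i \<in> {1..n} \<Longrightarrow> deg n (single i k) = k"
  by (simp add: deg_def lookup_single when_def)

text \<open>Iterating \<open>f g \<in> J\<close> modulo \<open>y\<close> gives \<open>g \<in> J + (y\<^sup>k)\<close> for all \<open>k\<close>, so
  every homogeneous component of \<open>g\<close> lies in \<open>J\<close>.\<close>

lemma nzd_lift:
  assumes J: "hom_ideal n J" and y: "y \<in> {1..n}" "nzd n J (Var y)"
    and f: "f \<in> PR n" "nzd n (ext n J (Var y)) f"
  shows "nzd n J f"
  unfolding nzd_def
proof (intro ballI impI)
  fix g assume g: "g \<in> PR n" "f * g \<in> J"
  have id: "is_ideal n J" using J by (simp add: hom_ideal_def)
  have yk: "Var y ^ k \<in> (PR n :: 'a mpoly set)" for k
    by (induction k) (simp_all add: Var_PR[OF y(1)])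
  have it: "\<exists>s\<in>PR n. g - Var y ^ k * s \<in> J \<and> f * s \<in> J" for k
  proof (induction k)
    case 0
    then show ?case using g id by (auto intro!: bexI[of _ g] ideal_0)
  next
    case (Suc k)
    then obtain s where s: "s \<in> PR n" "g - Var y ^ k * s \<in> J" "f * s \<in> J" by blast
    then have "s \<in> ext n J (Var y)" using nzdD[OF f(2)] ext_sub[of J n "Var y"] by blast
    then obtain a b where ab: "s = a + Var y * b" "a \<in> J" "b \<in> PR n" by (auto simp: ext_def)
    have "Var y * (f * b) = f * s - f * a" using ab by (simp add: algebra_simps)
    also have "\<dots> \<in> J" using s ab f id by (simp add: ideal_diff ideal_mult)
    finally have "f * b \<in> J" using nzdD[OF y(2)] ab f by simp
    moreover have "g - Var y ^ Suc k * b \<in> J"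
    proof -
      have "g - Var y ^ Suc k * b = (g - Var y ^ k * s) + Var y ^ k * a"
        using ab by (simp add: algebra_simps)
      also have "\<dots> \<in> J"
        by (intro ideal_add[OF id] ideal_mult[OF id]) (use s ab yk in auto)
      finally show ?thesis .
    qed
    ultimately show ?case using ab(3) by blast
  qed
  \<comment> \<open>The exponent \<open>Suc d\<close> exceeds \<open>d\<close>, so subtracting
    \<open>Var y ^ Suc d * s\<close> leaves the component of degree \<open>d\<close>
    unchanged.\<close>
  have "hc n d g \<in> J" for d
  proof -
    obtain s where s: "g - Var y ^ Suc d * s \<in> J" using it by blast
    have "homog n (Suc d) (Var y ^ Suc d :: 'a mpoly)"
      by (simp only: Var_power) (use deg_single[OF y(1)] in \<open>auto simp: homog_def\<close>)
    then have "hc n d (g - Var y ^ Suc d * s) = hc n d g"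
      by (simp only: hc_diff hc_mult_low[of n "Suc d"] lessI diff_zero)
    then show ?thesis using s J by (metis hom_ideal_def)
  qed
  then show "g \<in> J" using hc_sum[of g n] ideal_sum[OF id] by metis
qed

text \<open>Homogeneous regular sequences may be permuted: \<open>y\<close> moves from the front to
  the end, past one form at a time. \<open>nzd_lift\<close> makes the form regular before
  \<open>y\<close> is killed, and homogeneity of the form keeps the next ideal homogeneous.\<close>

lemma wreg_rotate:
  assumes "hom_ideal n J" "y \<in> {1..n}" "nzd n J (Var y)"
    and "\<forall>f\<in>set fs. f \<in> PR n \<and> (\<exists>c. homog n c f)"
    and "wreg n (ext n J (Var y)) fs"
  shows "wreg n J fs \<and> nzd n (foldl (ext n) J fs) (Var y)"
  using assms
proof (induction fs arbitrary: J)
  case Nil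
  then show ?case by simp
next
  case (Cons f fs)
  note y = Cons.prems(2,3)
  obtain c where f: "f \<in> PR n" "homog n c f" using Cons.prems by auto
  have id: "is_ideal n J" using Cons.prems by (simp add: hom_ideal_def)
  have nf: "nzd n (ext n J (Var y)) f" using Cons.prems by simp
  have 1: "nzd n J f" using nzd_lift[OF Cons.prems(1) y f(1) nf] .
  \<comment> \<open>In a relation y g = a + f b, regularity of \<open>f\<close> modulo
    \<open>y\<close> gives b = a' + y c, and then \<open>y\<close> can be cancelled from y (g - f
    c), which lies in \<open>J\<close>.\<close>
  have 2: "nzd n (ext n J f) (Var y)"
    unfolding nzd_def
  proof (intro ballI impI)
    fix g assume g: "g \<in> PR n" "Var y * g \<in> ext n J f"
    then obtain a b where ab: "Var y * g = a + f * b" "a \<in> J" "b \<in> PR n" by (auto simp: ext_def)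
    have "f * b = Var y * g - a" using ab by (simp add: algebra_simps)
    also have "\<dots> \<in> ext n J (Var y)"
      using ideal_diff[OF is_ideal_ext[OF id Var_PR[OF y(1)]], of "Var y * g" a] g ab
        ext_mem[OF id, of g "Var y"] ext_sub[of J n "Var y"] by blast
    finally have "b \<in> ext n J (Var y)" using nzdD[OF nf] ab by blast
    then obtain a' c where c: "b = a' + Var y * c" "a' \<in> J" "c \<in> PR n" by (auto simp: ext_def)
    have "Var y * (g - f * c) = a + f * a'" using ab c by (simp add: algebra_simps)
    also have "\<dots> \<in> J" using ab c id f by (simp add: ideal_add ideal_mult)
    finally have "g - f * c \<in> J" using nzdD[OF y(2), of "g - f * c"] g c f by simp
    moreover have "g = (g - f * c) + f * c" by simp
    ultimately show "g \<in> ext n J f" unfolding ext_def using c by blast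
  qed
  have "wreg n (ext n (ext n J f) (Var y)) fs"
    using Cons.prems(5) ext_commute[of n J f "Var y"] by simp
  then show ?case
    using Cons.IH[OF hom_ideal_ext[OF Cons.prems(1) f(2,1)] y(1) 2] 1 Cons.prems(4) by simp
qed

subsection \<open>Monomial ideals\<close>

definition upset :: "mono set \<Rightarrow> bool" where
  "upset J \<longleftrightarrow> (\<forall>u\<in>J. \<forall>v. u + v \<in> J)"

definition mdvd :: "mono \<Rightarrow> mono \<Rightarrow> bool" where
  "mdvd m u \<longleftrightarrow> (\<forall>i. lookup m i \<le> lookup u i)"

lemma mdvd_plus: "mdvd m u \<Longrightarrow> u = m + (u - m)"
  by (rule poly_mapping_eqI) (simp add: mdvd_def lookup_add lookup_minus)

lemma mdvd_iff: "mdvd m u \<longleftrightarrow> (\<exists>v. u = m + v)"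
  using mdvd_plus by (auto simp: mdvd_def lookup_add)

lemma keys_add_nat: "keys (a + b :: mono) = keys a \<union> keys b"
  by (auto simp: in_keys_iff lookup_add)

text \<open>The exponent set \<open>J\<close> may involve arbitrary variables; only here is it cut
  down to the first \<open>n\<close>, so exponent sets can be manipulated without reference to
  \<open>n\<close>.\<close>

definition MI :: "nat \<Rightarrow> mono set \<Rightarrow> 'a::field mpoly set" where
  "MI n J = {p \<in> PR n. keys p \<subseteq> J}"

lemma is_ideal_MI:
  assumes "upset J"
  shows "is_ideal n (MI n J)"
proof -
  have "keys (a + b) \<subseteq> J" if "keys a \<subseteq> J" "keys b \<subseteq> J" for a b :: "'a mpoly"
    using Poly_Mapping.keys_add[of a b] that by blast
  moreover have "keys (r * a) \<subseteq> J" if "keys a \<subseteq> J" for r a :: "'a mpoly"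
  proof
    fix m assume "m \<in> keys (r * a)"
    then obtain u v where "m = v + u" "v \<in> keys a"
      using keys_mult[of r a] by (auto simp: add.commute)
    then show "m \<in> J" using that assms by (auto simp: upset_def)
  qed
  ultimately show ?thesis by (auto simp: is_ideal_def MI_def)
qed

lemma hom_ideal_MI: "upset J \<Longrightarrow> hom_ideal n (MI n J)"
  using is_ideal_MI keys_hc hc_PR by (fastforce simp: hom_ideal_def MI_def)

lemma colon_MI: "keys m \<subseteq> {1..n} \<Longrightarrow> colon n (MI n J) (single m 1) = MI n {u. u + m \<in> J}"
  by (auto simp: colon_def MI_def keys_monom_mult add.commute)

lemma ext_MI:
  assumes J: "upset J" and m: "keys m \<subseteq> {1..n}"
  shows "ext n (MI n J) (single m (1::'a::field)) = MI n (J \<union> {u. mdvd m u})"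
proof (rule antisym)
  have U: "upset (J \<union> {u. mdvd m u})"
    using J by (auto simp: upset_def mdvd_iff add.assoc)
  note I = is_ideal_MI[OF this, of n]
  show "ext n (MI n J) (single m (1::'a)) \<subseteq> MI n (J \<union> {u. mdvd m u})"
  proof
    fix p :: "'a mpoly" assume "p \<in> ext n (MI n J) (single m 1)"
    then obtain a b where p: "p = a + single m 1 * b" "a \<in> MI n J" "b \<in> PR n"
      by (auto simp: ext_def)
    have "a \<in> MI n (J \<union> {u. mdvd m u})" using p by (auto simp: MI_def)
    moreover have "single m 1 * b \<in> MI n (J \<union> {u. mdvd m u})"
      using p m by (auto simp: MI_def keys_monom_mult mdvd_iff)
    ultimately show "p \<in> MI n (J \<union> {u. mdvd m u})" using p ideal_add[OF I] by blast
  qed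
  have E: "is_ideal n (ext n (MI n J) (single m (1::'a)))"
    by (intro is_ideal_ext is_ideal_MI J PR_single m)
  show "MI n (J \<union> {u. mdvd m u}) \<subseteq> ext n (MI n J) (single m (1::'a))"
  proof
    fix p :: "'a mpoly" assume p: "p \<in> MI n (J \<union> {u. mdvd m u})"
    have "single u (lookup p u) \<in> ext n (MI n J) (single m (1::'a))" if u: "u \<in> keys p" for u
    proof -
      have un: "keys u \<subseteq> {1..n}" using p u by (auto simp: MI_def PR_def)
      consider "u \<in> J" | v where "u = m + v" using p u by (auto simp: MI_def mdvd_iff)
      then show ?thesis
      proof cases
        case 1
        then have "single u (lookup p u) \<in> MI n J" using un by (auto simp: MI_def)
        then show ?thesis using ext_sub by blast
      next
        case 2
        then have "single v (lookup p u) \<in> PR n" using un by (intro PR_single) (auto simp: keys_add_nat)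
        then show ?thesis
          using ext_mem[OF is_ideal_MI[OF J], of "single v (lookup p u)" n "single m 1"] 2
          by (simp add: mult_single)
      qed
    qed
    then show "p \<in> ext n (MI n J) (single m (1::'a))"
      by (subst poly_expand) (intro ideal_sum[OF E])
  qed
qed

text \<open>The exponents of the monomial prime ideal generated by the variables in
  \<open>A\<close>.\<close>

definition hits :: "nat set \<Rightarrow> mono set" where
  "hits A = {u. \<exists>a\<in>A. lookup u a > 0}"

lemma upset_hits: "upset (hits A)"
  by (auto simp: upset_def hits_def lookup_add)

lemma mdvd_var: "mdvd (single y (Suc 0)) u \<longleftrightarrow> lookup u y > 0"
  by (auto simp: mdvd_def lookup_single when_def)

subsection \<open>Elementary symmetric polynomials as universal parameters\<close>

definition sqf :: "nat set \<Rightarrow> mono" where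
  "sqf T = (\<Sum>j\<in>T. single j 1)"

lemma lookup_sqf: "finite T \<Longrightarrow> lookup (sqf T) i = (if i \<in> T then 1 else 0)"
  by (simp add: sqf_def lookup_sum lookup_single when_def)

lemma keys_sqf: "finite T \<Longrightarrow> keys (sqf T) = T"
  by (auto simp: in_keys_iff lookup_sqf split: if_splits)

lemma deg_sqf: "T \<subseteq> {1..n} \<Longrightarrow> deg n (sqf T) = card T"
proof -
  assume T: "T \<subseteq> {1..n}"
  then have "finite T" by (rule finite_subset) simp
  then have "deg n (sqf T) = (\<Sum>i\<in>{1..n}. if i \<in> T then 1 else 0)"
    by (simp add: deg_def lookup_sqf)
  also have "\<dots> = card T" using T by (simp add: sum.If_cases Int_absorb1)
  finally show ?thesis .
qed

definition esym :: "nat \<Rightarrow> nat \<Rightarrow> 'a::field mpoly" where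
  "esym n k = (\<Sum>T | T \<subseteq> {1..n} \<and> card T = k. single (sqf T) 1)"

lemma keys_esym: "keys (esym n k) \<subseteq> sqf ` {T. T \<subseteq> {1..n} \<and> card T = k}"
  unfolding esym_def by (rule order_trans[OF Poly_Mapping.keys_sum]) auto

lemma esym_PR: "esym n k \<in> PR n"
  unfolding esym_def
  by (intro PR_sum PR_single) (auto simp: keys_sqf finite_subset[of _ "{1..n}"])

lemma homog_esym: "homog n k (esym n k)"
  unfolding homog_def using keys_esym[of n k] by (auto simp: deg_sqf)

definition esyms :: "nat \<Rightarrow> nat \<Rightarrow> 'a::field mpoly list" where
  "esyms n r = map (esym n) [1..<Suc r]"

lemma esyms_Suc: "esyms n (Suc r) = esyms n r @ [esym n (Suc r)]"
  by (simp add: esyms_def)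

lemma length_esyms: "length (esyms n r) = r"
  by (simp add: esyms_def)

lemma set_esyms: "set (esyms n r) \<subseteq> PR n"
  by (auto simp: esyms_def esym_PR)

lemma foldl_ext:
  assumes "is_ideal n J" "set fs \<subseteq> PR n"
  shows "is_ideal n (foldl (ext n) J fs) \<and> J \<subseteq> foldl (ext n) J fs"
  using assms
proof (induction fs arbitrary: J)
  case Nil
  then show ?case by simp
next
  case (Cons f fs)
  then show ?case using is_ideal_ext[of n J f] ext_sub[of J n f] by fastforce
qed

lemma nzd_sqf:
  assumes "finite B" "B \<subseteq> {1..n}" "\<And>y. y \<in> B \<Longrightarrow> nzd n J (Var y)"
  shows "nzd n J (single (sqf B) (1::'a::field))"
  using assms
proof (induction B)
  case empty
  then show ?case by (simp add: sqf_def nzd_def)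
next
  case (insert y B)
  have "single (sqf (insert y B)) (1::'a) = Var y * single (sqf B) 1"
    using insert by (simp add: sqf_def Var_def mult_single)
  moreover have "single (sqf B) (1::'a) \<in> PR n"
    using insert by (intro PR_single) (auto simp: keys_sqf)
  moreover have "nzd n J (Var y)" "nzd n J (single (sqf B) (1::'a))"
    using insert by auto
  ultimately show ?case
    by (simp add: nzd_def mult.assoc)
qed

text \<open>On \<open>K[x\<^sub>b : b \<in> B]\<close> with \<open>|B| = b\<close> the last parameter \<open>e\<^sub>b\<close> is the product of the
  variables, and \<open>e\<^sub>1, \<dots>, e\<^bsub>b-1\<^esub>\<close> are handled by killing one variable.\<close>

lemma wreg_hits:
  assumes "A \<subseteq> {1..n}" "r \<le> card ({1..n} - A)"
  shows "wreg n (MI n (hits A)) (esyms n r :: 'a::field mpoly list)"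
proof -
  have "wreg n (MI n (hits A)) (esyms n r :: 'a::field mpoly list)"
    if "card ({1..n} - A) = b" "A \<subseteq> {1..n}" "r \<le> b" for b A r
    using that
  proof (induction b arbitrary: A r)
    case 0
    then show ?case by (simp add: esyms_def)
  next
    case (Suc b)
    let ?J = "MI n (hits A) :: 'a mpoly set"
    let ?B = "{1..n} - A"
    have hJ: "hom_ideal n ?J" by (intro hom_ideal_MI upset_hits)
    then have J: "is_ideal n ?J" by (simp add: hom_ideal_def)
    \<comment> \<open>Killing a surviving variable \<open>y\<close> leaves the same sequence over
      one variable fewer. Rotating \<open>y\<close> to the end shows in addition that every
      surviving variable is regular modulo the first \<open>b\<close> parameters.\<close>
    have rot: "wreg n ?J (esyms n s) \<and> nzd n (foldl (ext n) ?J (esyms n s)) (Var y)"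
      if y: "y \<in> ?B" and s: "s \<le> b" for y s
    proof (rule wreg_rotate[OF hJ])
      show "y \<in> {1..n}" using y by simp
      have "keys g \<subseteq> hits A" if "keys (Var y * g) \<subseteq> hits A" for g :: "'a mpoly"
      proof
        fix u assume "u \<in> keys g"
        then have "single y 1 + u \<in> hits A"
          using that by (auto simp: Var_def keys_monom_mult)
        then show "u \<in> hits A"
          using y by (auto simp: hits_def lookup_add lookup_single when_def split: if_splits)
      qed
      then show "nzd n ?J (Var y)" by (auto simp: nzd_def MI_def)
      show "\<forall>f\<in>set (esyms n s). f \<in> PR n \<and> (\<exists>c. homog n c (f :: 'a mpoly))"
        by (auto simp: esyms_def esym_PR intro: homog_esym)
      have "hits A \<union> {u. mdvd (single y 1) u} = hits (insert y A)"
        by (auto simp: hits_def mdvd_var)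
      then have "ext n ?J (Var y) = MI n (hits (insert y A))"
        unfolding Var_def
        by (subst ext_MI) (use upset_hits y keys_single_sub[of y "1::nat"] in auto)
      moreover have "{1..n} - insert y A = ?B - {y}" by auto
      then have "card ({1..n} - insert y A) = b" using Suc.prems(1) y by simp
      ultimately show "wreg n (ext n ?J (Var y)) (esyms n s)"
        using Suc.IH[of "insert y A" s] Suc.prems y s by simp
    qed
    have "?B \<noteq> {}" using Suc.prems(1) by (metis card.empty nat.distinct(1))
    then obtain y where y: "y \<in> ?B" by blast
    show ?case
    proof (cases "r \<le> b")
      case True
      then show ?thesis using rot[OF y] by blast
    next
      case False
      then have r: "r = Suc b" using Suc.prems(3) by simp
      let ?J' = "foldl (ext n) ?J (esyms n b)"
      have J': "is_ideal n ?J'" "?J \<subseteq> ?J'" using foldl_ext[OF J set_esyms] by auto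
      have nz: "nzd n ?J' (single (sqf ?B) 1)"
        by (rule nzd_sqf) (use rot in auto)
      have fin: "finite {T. T \<subseteq> {1..n} \<and> card T = Suc b}" by simp
      \<comment> \<open>Every other set of \<open>Suc b\<close> indices meets \<open>A\<close>, so
        modulo \<open>?J\<close> the last parameter is the product of the surviving
        variables.\<close>
      have "esym n (Suc b) - single (sqf ?B) 1
          = (\<Sum>T\<in>{T. T \<subseteq> {1..n} \<and> card T = Suc b} - {?B}. single (sqf T) (1::'a))"
        unfolding esym_def using fin Suc.prems(1) by (subst sum.remove[of _ ?B]) auto
      also have "\<dots> \<in> ?J"
      proof (rule ideal_sum[OF J])
        fix T assume T: "T \<in> {T. T \<subseteq> {1..n} \<and> card T = Suc b} - {?B}"
        then have finT: "finite T" by (auto intro: finite_subset[of _ "{1..n}"])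
        have "\<not> T \<subseteq> ?B" using T Suc.prems(1) card_subset_eq[of ?B T] by auto
        then have "sqf T \<in> hits A" using T finT by (auto simp: hits_def lookup_sqf)
        then show "single (sqf T) (1::'a) \<in> ?J"
          using T finT by (auto simp: MI_def keys_sqf)
      qed
      finally have d: "esym n (Suc b) - single (sqf ?B) 1 \<in> ?J" .
      have "nzd n ?J' (esym n (Suc b))"
        unfolding nzd_def
      proof (intro ballI impI)
        fix g assume g: "g \<in> PR n" "esym n (Suc b) * g \<in> ?J'"
        have "single (sqf ?B) 1 * g = esym n (Suc b) * g - g * (esym n (Suc b) - single (sqf ?B) 1)"
          by (simp add: algebra_simps)
        also have "\<dots> \<in> ?J'"
          using g(2) ideal_mult[OF J'(1) g(1)] d J'(2) by (blast intro: ideal_diff[OF J'(1)])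
        finally show "g \<in> ?J'" using nzdD[OF nz] g by blast
      qed
      then show ?thesis using rot[OF y, of b] by (simp add: r esyms_Suc wreg_append)
    qed
  qed
  then show ?thesis using assms by blast
qed

subsection \<open>Filtrations by colons\<close>

text \<open>\<open>filt V r J\<close> certifies depth at least \<open>r\<close> for the quotient by \<open>J\<close> over the variables in \<open>V\<close>.\<close>

inductive filt :: "nat set \<Rightarrow> nat \<Rightarrow> mono set \<Rightarrow> bool" where
  whole: "filt V r UNIV"
| leaf: "A \<subseteq> V \<Longrightarrow> r \<le> card (V - A) \<Longrightarrow> filt V r (hits A)"
| split: "upset J \<Longrightarrow> keys m \<subseteq> V \<Longrightarrow> filt V r {u. u + m \<in> J}
    \<Longrightarrow> filt V r (J \<union> {u. mdvd m u}) \<Longrightarrow> filt V r J"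

text \<open>The parameters depend only on \<open>n\<close> and \<open>r\<close>, so the same
  sequence serves at all leaves, and \<open>wreg_split\<close> glues at each splitting.\<close>

lemma filt_wreg: "filt {1..n} r J \<Longrightarrow> wreg n (MI n J) (esyms n r :: 'a::field mpoly list)"
proof (induction "{1..n}" r J rule: filt.induct)
  case (whole r)
  have "MI n UNIV = (PR n :: 'a mpoly set)" by (auto simp: MI_def)
  then show ?case by (simp add: wreg_PR set_esyms)
next
  case (leaf A r)
  then show ?case by (rule wreg_hits)
next
  case (split J m r)
  show ?case
    by (rule wreg_split[of _ _ "single m 1"])
      (use split in \<open>simp_all add: is_ideal_MI set_esyms colon_MI ext_MI\<close>)
qed

lemma filt_mono: "filt V r J \<Longrightarrow> s \<le> r \<Longrightarrow> filt V s J"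
  by (induction rule: filt.induct) (auto intro: filt.intros)

text \<open>Neither the splitting monomials nor the leaves involve \<open>y\<close>, so every leaf
  gains one surviving variable.\<close>

lemma filt_free: "filt V r J \<Longrightarrow> finite V \<Longrightarrow> y \<notin> V \<Longrightarrow> filt (insert y V) (Suc r) J"
proof (induction rule: filt.induct)
  case (leaf A V r)
  then have "insert y V - A = insert y (V - A)" by auto
  then show ?case using leaf by (intro filt.leaf) auto
next
  case (split J m V r)
  then show ?case using filt.split[of J m "insert y V" "Suc r"] by auto
qed (auto intro: filt.intros)

text \<open>Adding \<open>y\<close> to the killed variables of each leaf leaves the number of
  surviving ones unchanged. The splitting monomials avoid \<open>y\<close>, so their colons commute
  with adding \<open>y\<close>.\<close>

lemma filt_kill: "filt V r J \<Longrightarrow> y \<notin> V \<Longrightarrow> filt (insert y V) r (J \<union> hits {y})"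
proof (induction rule: filt.induct)
  case (whole V r)
  then show ?case by (simp add: filt.whole)
next
  case (leaf A V r)
  then have "insert y V - insert y A = V - A" by auto
  moreover have "hits A \<union> hits {y} = hits (insert y A)" by (auto simp: hits_def)
  ultimately show ?case using leaf filt.leaf[of "insert y A" "insert y V" r] by auto
next
  case (split J m V r)
  have "upset (J \<union> hits {y})" using split(1) upset_hits by (auto simp: upset_def)
  moreover have "lookup m y = 0" using split by (metis in_keys_iff subsetD)
  then have "{u. u + m \<in> J \<union> hits {y}} = {u. u + m \<in> J} \<union> hits {y}"
    by (auto simp: hits_def lookup_add)
  moreover have "J \<union> hits {y} \<union> {u. mdvd m u} = J \<union> {u. mdvd m u} \<union> hits {y}" by auto
  ultimately show ?case using split filt.split[of "J \<union> hits {y}" m "insert y V" r] by auto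
qed

subsection \<open>Regular sequences from filtrations\<close>

text \<open>Connects extension by one element at a time, as in \<open>wreg\<close>, with the ideals
  generated by initial segments in \<open>regular_seq\<close>.\<close>

lemma foldl_ext_gen:
  assumes "is_ideal n J" "set fs \<subseteq> PR n"
  shows "foldl (ext n) J fs = ideal_gen n (J \<union> set fs)"
proof (rule antisym)
  have JP: "J \<union> set fs \<subseteq> PR n" using assms ideal_PR by auto
  have sub: "foldl (ext n) J fs \<subseteq> K" if "J \<subseteq> K" "set fs \<subseteq> K" "is_ideal n K" for K
    using assms that
  proof (induction fs arbitrary: J)
    case Nil
    then show ?case by simp
  next
    case (Cons f fs)
    have "ext n J f \<subseteq> K"
      using ext_eq_gen[of n J f] ideal_gen_least[of n K "J \<union> {f}"] Cons.prems by auto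
    then show ?case using Cons is_ideal_ext[of n J f] by auto
  qed
  show "foldl (ext n) J fs \<subseteq> ideal_gen n (J \<union> set fs)"
    by (intro sub is_ideal_gen JP) (auto intro: ideal_gen.gen)
  have "set fs \<subseteq> foldl (ext n) J fs"
    using assms
  proof (induction fs arbitrary: J)
    case Nil
    then show ?case by simp
  next
    case (Cons f fs)
    have "f \<in> ext n J f" using ext_mem[OF Cons.prems(1), of 1 f] by simp
    then show ?case
      using Cons foldl_ext[of n "ext n J f" fs] is_ideal_ext[of n J f] by auto
  qed
  then show "ideal_gen n (J \<union> set fs) \<subseteq> foldl (ext n) J fs"
    using foldl_ext[OF assms] by (intro ideal_gen_least) auto
qed

lemma wreg_nth:
  assumes "wreg n J fs" "i < length fs"
  shows "nzd n (foldl (ext n) J (take i fs)) (fs ! i)"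
  using assms
proof (induction fs arbitrary: J i)
  case Nil
  then show ?case by simp
next
  case (Cons f fs)
  then show ?case by (cases i) auto
qed

lemma esym_max_ideal: "k > 0 \<Longrightarrow> (esym n k :: 'a::field mpoly) \<in> max_ideal n"
proof -
  assume k: "k > 0"
  have I: "is_ideal n (max_ideal n :: 'a mpoly set)"
    unfolding max_ideal_def by (rule is_ideal_gen) (auto intro: Var_PR)
  have "single (sqf T) (1::'a) \<in> max_ideal n" if T: "T \<subseteq> {1..n}" "card T = k" for T
  proof -
    have fin: "finite T" using T(1) by (rule finite_subset) simp
    obtain y where y: "y \<in> T" using T k by fastforce
    have "single (sqf T) (1::'a) = single (sqf (T - {y})) 1 * Var y"
      using fin y by (simp add: sqf_def Var_def mult_single sum.remove add.commute)
    moreover have "Var y \<in> (max_ideal n :: 'a mpoly set)"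
      unfolding max_ideal_def using T y by (intro ideal_gen.gen) auto
    moreover have "single (sqf (T - {y})) (1::'a) \<in> PR n"
      using T fin by (intro PR_single) (auto simp: keys_sqf)
    ultimately show ?thesis using ideal_mult[OF I] by simp
  qed
  then show ?thesis unfolding esym_def by (intro ideal_sum[OF I]) auto
qed

text \<open>The certificate makes the elementary symmetric polynomials a regular sequence. The
  hypothesis \<open>0 \<notin> J\<close> says that the monomial ideal does not contain 1, which
  gives properness.\<close>

lemma depth_filt:
  assumes J: "upset J" "0 \<notin> J" and f: "filt {1..n} r J"
  shows "depth n (MI n J :: 'a::field mpoly set) \<ge> enat r"
proof -
  let ?J = "MI n J :: 'a mpoly set" and ?fs = "esyms n r :: 'a mpoly list"
  note I = is_ideal_MI[OF J(1), of n]
  have "?fs ! i \<in> max_ideal n \<and> (\<forall>g\<in>PR n. ?fs ! i * g \<in> ideal_gen n (?J \<union> set (take i ?fs))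
      \<longrightarrow> g \<in> ideal_gen n (?J \<union> set (take i ?fs)))" if i: "i < length ?fs" for i
  proof -
    have "set (take i ?fs) \<subseteq> PR n" using set_esyms set_take_subset by fast
    note foldl_ext_gen[OF I this]
    moreover have "?fs ! i \<in> max_ideal n"
      using i esym_max_ideal[of "Suc i" n, where 'a='a] by (simp add: esyms_def del: upt_Suc)
    ultimately show ?thesis
      using wreg_nth[OF filt_wreg[OF f] i] by (simp add: nzd_def)
  qed
  moreover have "ideal_gen n (?J \<union> set ?fs) \<noteq> PR n"
  proof -
    \<comment> \<open>The polynomials without constant term form a proper ideal that contains both
      \<open>?J\<close> and the parameters.\<close>
    let ?Z = "MI n {u. u \<noteq> 0} :: 'a mpoly set"
    have "upset {u :: mono. u \<noteq> 0}"
      by (auto simp: upset_def poly_mapping_eq_iff fun_eq_iff lookup_add)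
    then have Z: "is_ideal n ?Z" by (rule is_ideal_MI)
    have "?J \<subseteq> ?Z" using J(2) by (auto simp: MI_def)
    moreover have "esym n (Suc k) \<in> ?Z" for k
    proof -
      have "sqf T \<noteq> 0" if "T \<subseteq> {1..n}" "card T = Suc k" for T
        using that keys_sqf[of T] finite_subset[OF that(1)] by (metis card.empty finite_atLeastAtMost keys_zero nat.distinct(1))
      then show ?thesis using keys_esym[of n "Suc k"] esym_PR by (auto simp: MI_def)
    qed
    then have "set ?fs \<subseteq> ?Z" by (auto simp: esyms_def gr0_conv_Suc Suc_le_eq simp del: upt_Suc)
    ultimately have "ideal_gen n (?J \<union> set ?fs) \<subseteq> ?Z" by (intro ideal_gen_least Z) auto
    moreover have "1 \<notin> ?Z" by (simp add: MI_def)
    ultimately show ?thesis using PR_1 by blast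
  qed
  ultimately have "regular_seq n ?J ?fs" by (simp add: regular_seq_def)
  then have "enat (length ?fs) \<le> depth n ?J"
    unfolding depth_def by (intro SUP_upper) simp
  then show ?thesis by (simp add: length_esyms)
qed

subsection \<open>Powers of monomial ideals and their colons\<close>

text \<open>The exponents in the \<open>t\<close>-th power of the monomial ideal generated by
  \<open>G\<close>; a multiset records a product of \<open>t\<close> generators with
  repetition.\<close>

definition pw :: "mono set \<Rightarrow> nat \<Rightarrow> mono set" where
  "pw G t = {u. \<exists>M. set_mset M \<subseteq> G \<and> size M = t \<and> mdvd (\<Sum>\<^sub># M) u}"

text \<open>The colon of the \<open>t\<close>-th power by the monomial \<open>m\<close>. Stripping a
  leaf leaves a colon by its neighbour, so \<open>m\<close> has to be carried along.\<close>

definition qpw :: "mono set \<Rightarrow> nat \<Rightarrow> mono \<Rightarrow> mono set" where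
  "qpw G t m = {u. u + m \<in> pw G t}"

text \<open>The generators that survive setting the variable \<open>y\<close> to zero.\<close>

definition del :: "mono set \<Rightarrow> nat \<Rightarrow> mono set" where
  "del G y = {g \<in> G. lookup g y = 0}"

lemma upset_pw: "upset (pw G t)"
  unfolding upset_def pw_def mdvd_def by (auto simp: lookup_add intro: trans_le_add1)

lemma upset_qpw: "upset (qpw G t m)"
  unfolding upset_def qpw_def
proof (intro ballI allI CollectI)
  fix u v assume "u \<in> {u. u + m \<in> pw G t}"
  then have "(u + m) + v \<in> pw G t" using upset_pw[of G t] by (simp add: upset_def)
  then show "u + v + m \<in> pw G t" by (simp add: ac_simps)
qed

lemma qpw_0 [simp]: "qpw G 0 m = UNIV"
  by (auto simp: qpw_def pw_def mdvd_def)

lemma qpw_empty: "qpw {} (Suc t) m = hits {}"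
  by (auto simp: qpw_def pw_def hits_def)

lemma upset_Un: "upset J \<Longrightarrow> upset K \<Longrightarrow> upset (J \<union> K)"
  by (auto simp: upset_def)

lemma upset_mdvd: "upset {u. mdvd m u}"
  by (auto simp: upset_def mdvd_iff add.assoc)

lemma colon_qpw: "{u. u + m' \<in> qpw G t m} = qpw G t (m + m')"
  by (simp add: qpw_def ac_simps)

lemma sum_mset_lookup_0: "(\<And>g. g \<in># M \<Longrightarrow> lookup g z = 0) \<Longrightarrow> lookup (\<Sum>\<^sub># M) z = 0"
  by (induction M) (auto simp: lookup_add)

lemma mdvd_sum_mset: "g \<in># M \<Longrightarrow> mdvd g (\<Sum>\<^sub># M)"
  by (auto simp: mdvd_iff sum_mset.remove)

text \<open>A product containing \<open>e\<close> loses one factor by cancellation, so only products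
  that avoid \<open>e\<close> need an argument. Colons commute, which allows the additional
  \<open>m\<close>.\<close>

lemma pw_colon:
  assumes e: "e \<in> G"
    and other: "\<And>M u. set_mset M \<subseteq> G \<Longrightarrow> e \<notin># M \<Longrightarrow> size M = Suc t \<Longrightarrow> mdvd (\<Sum>\<^sub># M) (u + e)
      \<Longrightarrow> u \<in> pw G t"
  shows "{u. u + e \<in> qpw G (Suc t) m} = qpw G t m"
proof -
  have "u + e \<in> pw G (Suc t) \<longleftrightarrow> u \<in> pw G t" for u
  proof
    assume "u + e \<in> pw G (Suc t)"
    then obtain M where M: "set_mset M \<subseteq> G" "size M = Suc t" "mdvd (\<Sum>\<^sub># M) (u + e)"
      by (auto simp: pw_def)
    show "u \<in> pw G t"
    proof (cases "e \<in># M")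
      case True
      then have "set_mset (M - {#e#}) \<subseteq> G" "size (M - {#e#}) = t"
        using M by (auto simp: size_Diff_singleton dest: in_diffD)
      moreover have "mdvd (\<Sum>\<^sub># (M - {#e#})) u"
        using M(3) True by (simp add: mdvd_def sum_mset.remove lookup_add)
      ultimately show ?thesis unfolding pw_def by blast
    next
      case False
      then show ?thesis using other M by blast
    qed
  next
    assume "u \<in> pw G t"
    then obtain M where "set_mset M \<subseteq> G" "size M = t" "mdvd (\<Sum>\<^sub># M) u" by (auto simp: pw_def)
    then have "set_mset (add_mset e M) \<subseteq> G \<and> size (add_mset e M) = Suc t
        \<and> mdvd (\<Sum>\<^sub># (add_mset e M)) (u + e)"
      using e by (auto simp: mdvd_def lookup_add)
    then show "u + e \<in> pw G (Suc t)" unfolding pw_def by blast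
  qed
  from this[of "_ + m"] show ?thesis
    by (simp add: qpw_def add.assoc add.commute[of e m])
qed

section \<open>Splitting off leaf edges\<close>

abbreviation X :: "nat \<Rightarrow> mono" where "X j \<equiv> single j 1"

text \<open>A product avoiding the leaf edge is not divisible by \<open>z\<close>. Dropping one
  suitable factor therefore only has to compensate for the single \<open>y\<close> in the
  edge.\<close>

lemma leaf_colon:
  assumes e: "X z + X y \<in> G" and z: "\<And>g. g \<in> G \<Longrightarrow> g \<noteq> X z + X y \<Longrightarrow> lookup g z = 0"
    and zy: "z \<noteq> y"
  shows "{u. u + (X z + X y) \<in> qpw G (Suc t) m} = qpw G t m"
proof (rule pw_colon[OF e])
  fix M u
  assume M: "set_mset M \<subseteq> G" "X z + X y \<notin># M" "size M = Suc t" "mdvd (\<Sum>\<^sub># M) (u + (X z + X y))"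
  have z0: "lookup (\<Sum>\<^sub># M) z = 0" using M z by (intro sum_mset_lookup_0) blast
  \<comment> \<open>A factor containing \<open>y\<close> if there is one; otherwise \<open>y\<close>
    does not occur in the product and any factor may be dropped.\<close>
  obtain g where g: "g \<in># M" "lookup g y > 0 \<or> lookup (\<Sum>\<^sub># M) y = 0"
  proof (cases "\<exists>g\<in>#M. lookup g y > 0")
    case False
    then have "lookup (\<Sum>\<^sub># M) y = 0" by (intro sum_mset_lookup_0) auto
    moreover obtain g where "g \<in># M" using M(3) by (metis multiset_nonemptyE size_empty nat.distinct(1))
    ultimately show ?thesis using that by blast
  qed (use that in blast)
  let ?M = "M - {#g#}"
  have s: "\<Sum>\<^sub># M = g + \<Sum>\<^sub># ?M" using g(1) by (simp add: sum_mset.remove)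
  have "lookup (\<Sum>\<^sub># ?M) i \<le> lookup u i" for i
  proof -
    have "lookup g i + lookup (\<Sum>\<^sub># ?M) i \<le> lookup u i + lookup (X z) i + lookup (X y) i"
      using M(4) by (simp add: mdvd_def s lookup_add add.assoc)
    then show ?thesis
      using z0 g(2) by (cases "i = z"; cases "i = y")
        (auto simp: s lookup_add lookup_single when_def split: if_splits)
  qed
  moreover have "set_mset ?M \<subseteq> G" "size ?M = t"
    using M g by (auto simp: size_Diff_singleton dest: in_diffD)
  ultimately show "u \<in> pw G t" unfolding pw_def mdvd_def by blast
qed

text \<open>Outside \<open>hits {y}\<close> a product containing \<open>y\<close> cannot divide
  \<open>u + m\<close>. This needs \<open>m\<close> free of \<open>y\<close>, since otherwise
  \<open>m\<close> could supply the factor.\<close>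

lemma qpw_del:
  assumes "lookup m y = 0"
  shows "qpw G t m \<union> hits {y} = qpw (del G y) t m \<union> hits {y}"
proof -
  have "u \<in> qpw (del G y) t m" if u: "u \<in> qpw G t m" "lookup u y = 0" for u
  proof -
    obtain M where M: "set_mset M \<subseteq> G" "size M = t" "mdvd (\<Sum>\<^sub># M) (u + m)"
      using u(1) by (auto simp: qpw_def pw_def)
    have "lookup (\<Sum>\<^sub># M) y \<le> lookup (u + m) y" using M(3) by (simp add: mdvd_def)
    then have "lookup (\<Sum>\<^sub># M) y = 0" using u(2) assms by (simp add: lookup_add)
    then have "lookup g y = 0" if "g \<in># M" for g
      using mdvd_sum_mset[OF that] unfolding mdvd_def by (metis le_zero_eq)
    then have "set_mset M \<subseteq> del G y" using M(1) by (auto simp: del_def)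
    then show ?thesis using M by (auto simp: qpw_def pw_def)
  qed
  moreover have "qpw (del G y) t m \<subseteq> qpw G t m"
    by (auto simp: qpw_def pw_def del_def)
  ultimately show ?thesis by (auto simp: hits_def)
qed

lemma qpw_free:
  assumes "\<And>g. g \<in> G \<Longrightarrow> lookup g y = 0"
  shows "qpw G t (m + X y) = qpw G t m"
proof -
  have "mdvd (\<Sum>\<^sub># M) (u + (m + X y)) \<longleftrightarrow> mdvd (\<Sum>\<^sub># M) (u + m)" if M: "set_mset M \<subseteq> G" for M u
  proof -
    have "lookup (\<Sum>\<^sub># M) y = 0" using M assms by (intro sum_mset_lookup_0) blast
    then have "lookup (\<Sum>\<^sub># M) i \<le> lookup (u + (m + X y)) i
        \<longleftrightarrow> lookup (\<Sum>\<^sub># M) i \<le> lookup (u + m) i" for i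
      by (cases "i = y") (simp_all add: lookup_add lookup_single when_def)
    then show ?thesis by (simp add: mdvd_def)
  qed
  then show ?thesis unfolding qpw_def pw_def by blast
qed

text \<open>Splitting by zy and then by \<open>y\<close> gives three pieces: the lower power; the
  ideal with \<open>y\<close> killed; and the colon by \<open>y\<close> with \<open>z\<close>
  killed, because adding zy before the colon by \<open>y\<close> adds \<open>z\<close>. They
  correspond to hypotheses \<open>1\<close>, \<open>2\<close> and \<open>3\<close>.\<close>

lemma split_edge:
  assumes V: "z \<in> V" "y \<in> V" and m: "lookup m z = 0" "lookup m y = 0"
    and colon: "{u. u + (X z + X y) \<in> qpw G (Suc t) m} = qpw G t m"
    and 1: "filt V r (qpw G t m)"
    and 2: "filt (V - {y}) r (qpw (del G y) (Suc t) m)"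
    and 3: "filt (V - {z}) r (qpw (del G z) (Suc t) (m + X y))"
    and zy: "z \<noteq> y"
  shows "filt V r (qpw G (Suc t) m)"
proof (rule split[where m="X z + X y"])
  let ?J = "qpw G (Suc t) m \<union> {u. mdvd (X z + X y) u}"
  show "upset (qpw G (Suc t) m)" by (rule upset_qpw)
  show "keys (X z + X y) \<subseteq> V" using V by (auto simp: keys_add_nat)
  show "filt V r {u. u + (X z + X y) \<in> qpw G (Suc t) m}" using 1 colon by simp
  have dv: "mdvd (X z + X y) u \<longleftrightarrow> lookup u z > 0 \<and> lookup u y > 0" for u
  proof
    assume "mdvd (X z + X y) u"
    then have "lookup (X z + X y) z \<le> lookup u z" "lookup (X z + X y) y \<le> lookup u y"
      by (simp_all add: mdvd_def)
    then show "lookup u z > 0 \<and> lookup u y > 0" by (simp add: lookup_add)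
  qed (use zy in \<open>auto simp: mdvd_def lookup_add lookup_single when_def\<close>)
  show "filt V r ?J"
  proof (rule split[where m="X y"])
    show "upset ?J" by (intro upset_Un upset_qpw upset_mdvd)
    show "keys (X y) \<subseteq> V" using V by simp
    have "{u. u + X y \<in> ?J} = {u. u + X y \<in> qpw G (Suc t) m} \<union> hits {z}"
      using zy by (auto simp: dv[unfolded One_nat_def] hits_def lookup_add lookup_single when_def)
    also have "\<dots> = qpw (del G z) (Suc t) (m + X y) \<union> hits {z}"
      unfolding colon_qpw
      by (rule qpw_del) (use zy m in \<open>simp add: lookup_add lookup_single when_def\<close>)
    finally show "filt V r {u. u + X y \<in> ?J}"
      using filt_kill[OF 3, of z] V by (simp add: insert_absorb)
    have "?J \<union> {u. mdvd (X y) u} = qpw G (Suc t) m \<union> hits {y}"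
      by (auto simp: dv[unfolded One_nat_def] hits_def mdvd_var)
    also have "\<dots> = qpw (del G y) (Suc t) m \<union> hits {y}"
      by (rule qpw_del[OF m(2)])
    finally show "filt V r (?J \<union> {u. mdvd (X y) u})"
      using filt_kill[OF 2, of y] V by (simp add: insert_absorb)
  qed
qed

text \<open>Killing \<open>y\<close> isolates the leaf \<open>z\<close>. The free variable
  \<open>z\<close> contributes 1, so hypothesis \<open>2\<close> only asks for
  \<open>r\<close>.\<close>

lemma strip:
  assumes V: "finite V" "z \<in> V" "y \<in> V" and m: "lookup m z = 0" "lookup m y = 0"
    and e: "X z + X y \<in> G" and z: "\<And>g. g \<in> G \<Longrightarrow> g \<noteq> X z + X y \<Longrightarrow> lookup g z = 0"
    and zy: "z \<noteq> y"
    and 1: "filt V (Suc r) (qpw G t m)"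
    and 2: "filt (V - {z, y}) r (qpw (del G y) (Suc t) m)"
    and 3: "filt (V - {z}) (Suc r) (qpw (del G z) (Suc t) (m + X y))"
  shows "filt V (Suc r) (qpw G (Suc t) m)"
proof (rule split_edge[OF V(2,3) m leaf_colon[OF e z zy] 1 _ 3 zy])
  have "insert z (V - {z, y}) = V - {y}" using V zy by auto
  then show "filt (V - {y}) (Suc r) (qpw (del G y) (Suc t) m)"
    using filt_free[OF 2, of z] V by simp
qed

text \<open>Resolves the colon by \<open>y\<close> left over from \<open>strip\<close>, when
  \<open>y\<close> has itself become a leaf with neighbour \<open>x\<close>. The further colon by
  \<open>x\<close> is the colon by the leaf edge; killing \<open>x\<close> makes \<open>y\<close>
  free, so the colon by \<open>y\<close> disappears and \<open>y\<close> contributes 1.\<close>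

lemma strip2:
  assumes V: "finite V" "x \<in> V" "y \<in> V" and m: "lookup m x = 0"
    and e: "X y + X x \<in> G" and y: "\<And>g. g \<in> G \<Longrightarrow> g \<noteq> X y + X x \<Longrightarrow> lookup g y = 0"
    and xy: "y \<noteq> x"
    and 1: "filt V (Suc r) (qpw G t m)"
    and 2: "filt (V - {y, x}) r (qpw (del G x) (Suc t) m)"
  shows "filt V (Suc r) (qpw G (Suc t) (m + X y))"
proof (rule split[where m="X x"])
  show "upset (qpw G (Suc t) (m + X y))" by (rule upset_qpw)
  show "keys (X x) \<subseteq> V" using V by simp
  have "{u. u + X x \<in> qpw G (Suc t) (m + X y)} = {u. u + (X y + X x) \<in> qpw G (Suc t) m}"
    by (simp add: colon_qpw add.assoc)
  then show "filt V (Suc r) {u. u + X x \<in> qpw G (Suc t) (m + X y)}"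
    using 1 leaf_colon[OF e y xy] by simp
  have "{u. mdvd (X x) u} = hits {x}" by (auto simp: hits_def mdvd_var)
  then have "qpw G (Suc t) (m + X y) \<union> {u. mdvd (X x) u}
      = qpw (del G x) (Suc t) (m + X y) \<union> hits {x}"
    using qpw_del[of "m + X y" x G "Suc t"] m xy
    by (simp add: lookup_add lookup_single when_def)
  also have "qpw (del G x) (Suc t) (m + X y) = qpw (del G x) (Suc t) m"
  proof (rule qpw_free)
    fix g assume g: "g \<in> del G x"
    then have "g \<noteq> X y + X x" by (auto simp: del_def lookup_add)
    then show "lookup g y = 0" using g y[of g] by (simp add: del_def)
  qed
  also have "filt V (Suc r) (qpw (del G x) (Suc t) m \<union> hits {x})"
  proof -
    have "insert x (insert y (V - {y, x})) = V" using V xy by auto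
    then show ?thesis
      using filt_kill[OF filt_free[OF 2, of y], of x] V xy by simp
  qed
  finally show "filt V (Suc r) (qpw G (Suc t) (m + X y) \<union> {u. mdvd (X x) u})" .
qed

text \<open>Induction on the degree of \<open>g\<close>: for a variable \<open>x\<close> dividing
  \<open>g\<close>, the colon by \<open>x\<close> is generated by g/x, and adding \<open>x\<close>
  gives the prime ideal (x).\<close>

lemma filt_principal:
  assumes "finite V" "keys g \<subseteq> V"
  shows "filt V (card V - 1) {u. mdvd g u}"
  using assms(2)
proof (induction "\<Sum>i\<in>V. lookup g i" arbitrary: g rule: less_induct)
  case less
  show ?case
  proof (cases "g = 0")
    case True
    then have "{u. mdvd g u} = UNIV" by (auto simp: mdvd_def)
    then show ?thesis by (simp add: whole)
  next
    case False
    then obtain x where "x \<in> keys g" by (metis equals0I keys_eq_empty)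
    then have gx: "lookup g x > 0" and xV: "x \<in> V" using less.prems by (auto simp: in_keys_iff)
    let ?g = "g - X x"
    have "keys ?g \<subseteq> V" using less.prems by (auto simp: in_keys_iff lookup_minus)
    moreover have "(\<Sum>i\<in>V. lookup ?g i) < (\<Sum>i\<in>V. lookup g i)"
      by (rule sum_strict_mono_ex1) (use assms(1) xV gx in \<open>auto simp: lookup_minus intro!: bexI[of _ x]\<close>)
    ultimately have "filt V (card V - 1) {u. mdvd ?g u}" using less.hyps by blast
    moreover have "{u. u + X x \<in> {u. mdvd g u}} = {u. mdvd ?g u}"
      by (auto simp: mdvd_def lookup_add lookup_minus le_diff_conv)
    moreover have "{u. mdvd g u} \<union> {u. mdvd (X x) u} = hits {x}"
      using gx by (auto simp: hits_def mdvd_var) (auto simp: mdvd_def dest!: spec[of _ x])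
    moreover have "filt V (card V - 1) (hits {x})"
      by (rule leaf) (use xV assms(1) in simp_all)
    ultimately show ?thesis
      using split[OF upset_mdvd, of "X x" V "card V - 1" g] xV by simp
  qed
qed

text \<open>Powers of a principal monomial ideal and their colons are principal; the colon is
  generated by the truncated difference of exponents.\<close>

lemma filt_qpw_single:
  assumes "finite V" "keys g \<subseteq> V" "r < card V"
  shows "filt V r (qpw {g} t m)"
proof -
  let ?s = "\<Sum>\<^sub># (replicate_mset t g)"
  have M: "set_mset M \<subseteq> {g} \<and> size M = t \<longleftrightarrow> M = replicate_mset t g" for M
    by (metis set_mset_subset_singletonD size_replicate_mset set_mset_replicate_mset_subset
        empty_subsetI order_refl)
  have "qpw {g} t m = {u. mdvd ?s (u + m)}"
    unfolding qpw_def pw_def conj_assoc[symmetric] M by simp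
  also have "\<dots> = {u. mdvd (?s - m) u}"
    by (auto simp: mdvd_def lookup_add lookup_minus le_diff_conv)
  finally have eq: "qpw {g} t m = {u. mdvd (?s - m) u}" .
  have "keys ?s \<subseteq> keys g" by (induction t) (auto simp: keys_add_nat)
  moreover have "keys (?s - m) \<subseteq> keys ?s" by (auto simp: in_keys_iff lookup_minus)
  ultimately have "keys (?s - m) \<subseteq> V" using assms(2) by blast
  then show ?thesis
    using filt_mono[OF filt_principal[OF assms(1)]] assms(3) eq by simp
qed

subsection \<open>Edge ideals of weighted paths\<close>

definition edge :: "(nat \<Rightarrow> nat) \<Rightarrow> nat \<Rightarrow> mono" where
  "edge w j = single j (w j) + single (Suc j) (w j)"

text \<open>The interval of vertices is half-open: \<open>l, \<dots>, s - 1\<close>. With \<open>n = s - l\<close>, a bound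
  \<open>d \<le> max \<lceil>(n - t) / 3\<rceil> c\<close> is written \<open>3 * d + t + l \<le> s + 2 \<or> d \<le> c\<close> below.\<close>

definition path :: "(nat \<Rightarrow> nat) \<Rightarrow> nat \<Rightarrow> nat \<Rightarrow> mono set" where
  "path w l s = edge w ` {j. l \<le> j \<and> Suc j < s}"

definition path_depth :: "(nat \<Rightarrow> nat) \<Rightarrow> nat \<Rightarrow> nat \<Rightarrow> nat \<Rightarrow> nat \<Rightarrow> bool" where
  "path_depth w l s t d \<longleftrightarrow> filt {l..<s} d (qpw (path w l s) t 0)"

lemma lookup_edge: "lookup (edge w j) i = (if i = j \<or> i = Suc j then w j else 0)"
  by (simp add: edge_def lookup_add lookup_single when_def)

lemma path_depth_mono: "path_depth w l s t d \<Longrightarrow> d' \<le> d \<Longrightarrow> path_depth w l s t d'"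
  unfolding path_depth_def by (rule filt_mono)

lemma path_depth_0: "path_depth w l s 0 d"
  by (simp add: path_depth_def whole)

text \<open>An edge of weight 0 is the exponent 0 and survives every deletion. The lemmas below
  assume positive weights, so that deleting an end vertex or its neighbour leaves a shorter
  path.\<close>

lemma del_path:
  "del (path w l s) i = edge w ` {j. l \<le> j \<and> Suc j < s \<and> \<not> ((i = j \<or> i = Suc j) \<and> w j > 0)}"
  by (auto simp: del_def path_def lookup_edge)

lemma del_path_last:
  assumes "\<And>j. l \<le> j \<Longrightarrow> j < k \<Longrightarrow> w j > 0"
  shows "del (path w l (Suc k)) k = path w l k"
proof -
  have "l \<le> j \<and> Suc j < Suc k \<and> \<not> ((k = j \<or> k = Suc j) \<and> w j > 0) \<longleftrightarrow> l \<le> j \<and> Suc j < k" for j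
    using assms[of j] by (cases "Suc j = k") auto
  then show ?thesis unfolding del_path by (simp add: path_def)
qed

lemma del_path_penultimate:
  assumes "\<And>j. l \<le> j \<Longrightarrow> j \<le> k \<Longrightarrow> w j > 0"
  shows "del (path w l (Suc (Suc k))) k = path w l k"
proof -
  have "l \<le> j \<and> Suc j < Suc (Suc k) \<and> \<not> ((k = j \<or> k = Suc j) \<and> w j > 0)
      \<longleftrightarrow> l \<le> j \<and> Suc j < k" for j
    using assms[of j] by (cases "j = k"; cases "Suc j = k") auto
  then show ?thesis unfolding del_path by (simp add: path_def)
qed

lemma del_path_first:
  assumes "Suc l < s \<Longrightarrow> w l > 0"
  shows "del (path w l s) l = path w (Suc l) s"
proof -
  have "l \<le> j \<and> Suc j < s \<and> \<not> ((l = j \<or> l = Suc j) \<and> w j > 0) \<longleftrightarrow> Suc l \<le> j \<and> Suc j < s" for j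
    using assms by (cases "j = l") auto
  then show ?thesis unfolding del_path by (simp add: path_def)
qed

lemma del_path_second:
  assumes "Suc l < s \<Longrightarrow> w l > 0" "Suc (Suc l) < s \<Longrightarrow> w (Suc l) > 0"
  shows "del (path w l s) (Suc l) = path w (Suc (Suc l)) s"
proof -
  have "l \<le> j \<and> Suc j < s \<and> \<not> ((Suc l = j \<or> Suc l = Suc j) \<and> w j > 0)
      \<longleftrightarrow> Suc (Suc l) \<le> j \<and> Suc j < s" for j
    using assms by (cases "j = l"; cases "j = Suc l") auto
  then show ?thesis unfolding del_path by (simp add: path_def)
qed

lemma edge_unit: "w j = 1 \<Longrightarrow> edge w j = X j + X (Suc j)"
  by (simp add: edge_def)

lemma path_strip_right:
  assumes pos: "\<And>j. l \<le> j \<Longrightarrow> j \<le> k \<Longrightarrow> w j > 0" and lk: "l \<le> k" and unit: "w k = 1"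
    and m: "lookup m k = 0" "lookup m (Suc k) = 0"
    and 1: "filt {l..<Suc (Suc k)} (Suc d) (qpw (path w l (Suc (Suc k))) t m)"
    and 2: "filt {l..<k} d (qpw (path w l k) (Suc t) m)"
    and 3: "filt {l..<Suc k} (Suc d) (qpw (path w l (Suc k)) (Suc t) (m + X k))"
  shows "filt {l..<Suc (Suc k)} (Suc d) (qpw (path w l (Suc (Suc k))) (Suc t) m)"
proof (rule strip[where z="Suc k" and y=k])
  have e: "X (Suc k) + X k = edge w k" using edge_unit[of w k, OF unit] by (simp add: add.commute)
  show "X (Suc k) + X k \<in> path w l (Suc (Suc k))"
    unfolding e path_def using lk by simp
  show "lookup g (Suc k) = 0" if "g \<in> path w l (Suc (Suc k))" "g \<noteq> X (Suc k) + X k" for g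
    using that unfolding e by (auto simp: path_def lookup_edge)
  have "{l..<Suc (Suc k)} - {Suc k, k} = {l..<k}" by auto
  then show "filt ({l..<Suc (Suc k)} - {Suc k, k}) d (qpw (del (path w l (Suc (Suc k))) k) (Suc t) m)"
    using 2 del_path_penultimate[of l k w] pos by simp
  have "{l..<Suc (Suc k)} - {Suc k} = {l..<Suc k}" by auto
  then show "filt ({l..<Suc (Suc k)} - {Suc k}) (Suc d)
      (qpw (del (path w l (Suc (Suc k))) (Suc k)) (Suc t) (m + X k))"
    using 3 del_path_last[of l "Suc k" w] pos by simp
qed (use lk m 1 in auto)

lemma path_strip2_right:
  assumes pos: "\<And>j. l \<le> j \<Longrightarrow> j \<le> k \<Longrightarrow> w j > 0" and lk: "l \<le> k" and unit: "w k = 1"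
    and 1: "path_depth w l (Suc (Suc k)) t (Suc d)"
    and 2: "path_depth w l k (Suc t) d"
  shows "filt {l..<Suc (Suc k)} (Suc d) (qpw (path w l (Suc (Suc k))) (Suc t) (X (Suc k)))"
proof -
  have "filt {l..<Suc (Suc k)} (Suc d) (qpw (path w l (Suc (Suc k))) (Suc t) (0 + X (Suc k)))"
  proof (rule strip2[where x=k and y="Suc k"])
    have e: "X (Suc k) + X k = edge w k" using edge_unit[of w k, OF unit] by (simp add: add.commute)
    show "X (Suc k) + X k \<in> path w l (Suc (Suc k))"
      unfolding e path_def using lk by simp
    show "lookup g (Suc k) = 0" if "g \<in> path w l (Suc (Suc k))" "g \<noteq> X (Suc k) + X k" for g
      using that unfolding e by (auto simp: path_def lookup_edge)
    have "{l..<Suc (Suc k)} - {Suc k, k} = {l..<k}" by auto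
    then show "filt ({l..<Suc (Suc k)} - {Suc k, k}) d (qpw (del (path w l (Suc (Suc k))) k) (Suc t) 0)"
      using 2 del_path_penultimate[of l k w] pos by (simp add: path_depth_def)
  qed (use lk 1 in \<open>auto simp: path_depth_def\<close>)
  then show ?thesis by simp
qed

lemma path_strip_left:
  assumes pos: "\<And>j. l \<le> j \<Longrightarrow> Suc j < s \<Longrightarrow> w j > 0" and ls: "Suc l < s" and unit: "w l = 1"
    and m: "lookup m l = 0" "lookup m (Suc l) = 0"
    and 1: "filt {l..<s} (Suc d) (qpw (path w l s) t m)"
    and 2: "filt {Suc (Suc l)..<s} d (qpw (path w (Suc (Suc l)) s) (Suc t) m)"
    and 3: "filt {Suc l..<s} (Suc d) (qpw (path w (Suc l) s) (Suc t) (m + X (Suc l)))"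
  shows "filt {l..<s} (Suc d) (qpw (path w l s) (Suc t) m)"
proof (rule strip[where z=l and y="Suc l"])
  have e: "X l + X (Suc l) = edge w l" using edge_unit[of w l, OF unit] by simp
  show "X l + X (Suc l) \<in> path w l s"
    unfolding e path_def using ls by simp
  show "lookup g l = 0" if "g \<in> path w l s" "g \<noteq> X l + X (Suc l)" for g
    using that unfolding e by (auto simp: path_def lookup_edge)
  have "{l..<s} - {l, Suc l} = {Suc (Suc l)..<s}" by auto
  then show "filt ({l..<s} - {l, Suc l}) d (qpw (del (path w l s) (Suc l)) (Suc t) m)"
    using 2 del_path_second[of l s w] pos by simp
  have "{l..<s} - {l} = {Suc l..<s}" by auto
  then show "filt ({l..<s} - {l}) (Suc d) (qpw (del (path w l s) l) (Suc t) (m + X (Suc l)))"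
    using 3 del_path_first[of l s w] pos by simp
qed (use ls m 1 in auto)

lemma path_strip2_left:
  assumes pos: "\<And>j. l \<le> j \<Longrightarrow> Suc j < s \<Longrightarrow> w j > 0" and ls: "Suc l < s" and unit: "w l = 1"
    and 1: "path_depth w l s t (Suc d)"
    and 2: "path_depth w (Suc (Suc l)) s (Suc t) d"
  shows "filt {l..<s} (Suc d) (qpw (path w l s) (Suc t) (X l))"
proof -
  have "filt {l..<s} (Suc d) (qpw (path w l s) (Suc t) (0 + X l))"
  proof (rule strip2[where x="Suc l" and y=l])
    have e: "X l + X (Suc l) = edge w l" using edge_unit[of w l, OF unit] by simp
    show "X l + X (Suc l) \<in> path w l s"
      unfolding e path_def using ls by simp
    show "lookup g l = 0" if "g \<in> path w l s" "g \<noteq> X l + X (Suc l)" for g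
      using that unfolding e by (auto simp: path_def lookup_edge)
    have "{l..<s} - {l, Suc l} = {Suc (Suc l)..<s}" by auto
    then show "filt ({l..<s} - {l, Suc l}) d (qpw (del (path w l s) (Suc l)) (Suc t) 0)"
      using 2 del_path_second[of l s w] pos by (simp add: path_depth_def)
  qed (use ls 1 in \<open>auto simp: path_depth_def\<close>)
  then show ?thesis by simp
qed

text \<open>The recursion at the last two unit edges: \<open>path_strip_right\<close> removes the
  vertex \<open>k + 2\<close>, and \<open>path_strip2_right\<close> resolves the remaining colon by
  \<open>k + 1\<close>.\<close>

lemma path_depth_right:
  assumes pos: "\<And>j. l \<le> j \<Longrightarrow> j \<le> Suc k \<Longrightarrow> w j > 0" and lk: "l \<le> k"
    and unit: "w k = 1" "w (Suc k) = 1"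
    and "path_depth w l (k + 3) t (Suc d)" "path_depth w l (k + 1) (Suc t) d"
      "path_depth w l (k + 2) t (Suc d)" "path_depth w l k (Suc t) d"
  shows "path_depth w l (k + 3) (Suc t) (Suc d)"
  using path_strip_right[of l "Suc k" w 0 d t] path_strip2_right[of l k w t d] assms
  by (simp add: path_depth_def numeral_3_eq_3 numeral_2_eq_2)

lemma path_depth_left:
  assumes pos: "\<And>j. l \<le> j \<Longrightarrow> Suc j < s \<Longrightarrow> w j > 0" and ls: "l + 3 \<le> s"
    and unit: "w l = 1" "w (Suc l) = 1"
    and "path_depth w l s t (Suc d)" "path_depth w (l + 2) s (Suc t) d"
      "path_depth w (l + 1) s t (Suc d)" "path_depth w (l + 3) s (Suc t) d"
  shows "path_depth w l s (Suc t) (Suc d)"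
  using path_strip_left[of l s w 0 d t] path_strip2_left[of "Suc l" s w t d] assms
  by (simp add: path_depth_def numeral_3_eq_3 numeral_2_eq_2)

section \<open>Single edges and unweighted paths\<close>

lemma path_depth_trivial: "s \<le> Suc l \<Longrightarrow> d \<le> s - l \<Longrightarrow> path_depth w l s (Suc t) d"
proof -
  assume s: "s \<le> Suc l" and d: "d \<le> s - l"
  have "path w l s = {}" using s by (auto simp: path_def)
  then show ?thesis unfolding path_depth_def using d qpw_empty leaf[of "{}" "{l..<s}" d] by simp
qed

lemma path_single: "path w l (Suc (Suc l)) = {edge w l}"
proof -
  have "{j. l \<le> j \<and> Suc j < Suc (Suc l)} = {l}" by auto
  then show ?thesis by (simp add: path_def)
qed

lemma keys_edge: "keys (edge w l) \<subseteq> {l, Suc l}"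
  by (auto simp: in_keys_iff lookup_edge split: if_splits)

lemma path_depth_single: "d \<le> 1 \<Longrightarrow> path_depth w l (Suc (Suc l)) t d"
  unfolding path_depth_def path_single
  by (rule filt_qpw_single) (use keys_edge[of w l] in auto)

text \<open>With \<open>n = s - l\<close> this is the classical bound max \<lceil>(n - t + 1) /
  3\<rceil> 1; the condition \<open>l + d \<le> s\<close> restricts the lower bound 1 to nonempty
  paths.\<close>

lemma path_depth_unit:
  assumes "\<And>j. l \<le> j \<Longrightarrow> Suc j < s \<Longrightarrow> w j = 1" "t > 0" "l \<le> s"
    and "3 * d + t + l \<le> s + 3 \<or> d \<le> 1 \<and> l + d \<le> s"
  shows "path_depth w l s t d"
  using assms
proof (induction "s + t" arbitrary: s t d rule: less_induct)
  case less
  note unit = less.prems(1) and d = less.prems(4)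
  obtain t' where t: "t = Suc t'" using less.prems(2) gr0_implies_Suc by blast
  consider "s \<le> Suc l" | "s = Suc (Suc l)" | k where "s = k + 3" "l \<le> k"
  proof (cases "s \<le> Suc (Suc l)")
    case True
    then show ?thesis using that by linarith
  next
    case False
    then show ?thesis using that(3)[of "s - 3"] by simp
  qed
  then show ?case
  proof cases
    case 1
    then show ?thesis unfolding t using d t by (intro path_depth_trivial) linarith+
  next
    case 2
    then show ?thesis using d t by (auto intro!: path_depth_single)
  next
    case k: 3
    have *: "path_depth w l s' t'' d'"
      if "s' + t'' < s + t" "l \<le> s'" "s' \<le> s" "t'' = 0 \<or> 3 * d' + t'' + l \<le> s' + 3 \<or> d' \<le> 1 \<and> l + d' \<le> s'"
      for s' t'' d'
      using less.hyps[of s' t'' d'] that unit path_depth_0 by (cases "t'' = 0") auto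
    \<comment> \<open>Subtraction is truncated: \<open>d = 0\<close> and \<open>d = 1\<close> both
      give \<open>e = 0\<close>, and monotonicity returns from \<open>Suc e\<close> to
      \<open>d\<close>.\<close>
    define e where "e = d - 1"
    have e: "e = 0 \<or> 3 * e + t + l \<le> s" "d \<le> Suc e" using d by (auto simp: e_def)
    have "path_depth w l (k + 3) (Suc t') (Suc e)"
    proof (rule path_depth_right)
      show "path_depth w l (k + 3) t' (Suc e)"
        by (rule *) (use e k t in auto)
      show "path_depth w l (k + 1) (Suc t') e"
        by (rule *) (use e k t in auto)
      show "path_depth w l (k + 2) t' (Suc e)"
        by (rule *) (use e k t in auto)
      show "path_depth w l k (Suc t') e"
        by (rule *) (use e k t in auto)
    qed (use k unit in auto)
    then show ?thesis using k t e(2) by (simp add: path_depth_mono)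
  qed
qed

section \<open>Small configurations with heavy edges\<close>

text \<open>Stripping the unit leaf \<open>x1\<close> leaves an isolated vertex or one edge, whose
  powers are principal. The colon by a power of \<open>x3\<close> allows for unit edges already
  stripped beyond \<open>x3\<close>.\<close>

lemma filt_heavy_leaf:
  assumes "x1 \<noteq> x2" "x2 \<noteq> x3" "x1 \<noteq> x3" "0 < a"
  shows "filt {x1, x2, x3} 1 (qpw {X x1 + X x2, single x2 a + single x3 a} t (single x3 c))"
proof (induction t)
  case 0
  then show ?case by (simp add: whole)
next
  case (Suc t)
  let ?g = "single x2 a + single x3 a" and ?e = "X x1 + X x2"
  let ?G = "{?e, ?g}" and ?m = "single x3 c" and ?V = "{x1, x2, x3}"
  have "filt ?V (Suc 0) (qpw ?G (Suc t) ?m)"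
  proof (rule strip[where z=x1 and y=x2])
    show "lookup g x1 = 0" if "g \<in> ?G" "g \<noteq> ?e" for g
      using that assms by (auto simp: lookup_add lookup_single when_def)
    have "del ?G x2 = {}" using assms by (auto simp: del_def lookup_add lookup_single when_def)
    then show "filt (?V - {x1, x2}) 0 (qpw (del ?G x2) (Suc t) ?m)"
      using leaf[of "{}"] by (simp add: qpw_empty)
    have del: "del ?G x1 = {?g}" using assms by (auto simp: del_def lookup_add lookup_single when_def)
    have V: "?V - {x1} = {x2, x3}" using assms by auto
    show "filt (?V - {x1}) (Suc 0) (qpw (del ?G x1) (Suc t) (?m + X x2))"
      unfolding del V
      by (rule filt_qpw_single)
        (use assms keys_single_sub in \<open>auto simp: keys_add_nat card_insert_if\<close>)
  qed (use Suc assms in \<open>auto simp: lookup_single when_def\<close>)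
  then show ?case by simp
qed

text \<open>The middle edge satisfies the colon identity of a leaf edge. Killing either of its
  vertices leaves a heavy edge and an isolated vertex, each contributing 1. The colon by powers of
  the end vertices allows for stripped neighbours on both sides.\<close>

lemma filt_heavy_pair:
  assumes "distinct [x1, x2, x3, x4]" "a \<ge> 2" "b \<ge> 2"
  shows "filt {x1, x2, x3, x4} 2
    (qpw {single x1 a + single x2 a, X x2 + X x3, single x3 b + single x4 b} t (single x1 c + single x4 c'))"
proof (induction t)
  case 0
  then show ?case by (simp add: whole)
next
  case (Suc t)
  let ?g = "single x1 a + single x2 a" and ?h = "single x3 b + single x4 b" and ?e = "X x3 + X x2"
  let ?G = "{?g, X x2 + X x3, ?h}" and ?m = "single x1 c + single x4 c'" and ?V = "{x1, x2, x3, x4}"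
  have e: "?e = X x2 + X x3" by (rule add.commute)
  have d: "x1 \<noteq> x2" "x1 \<noteq> x3" "x1 \<noteq> x4" "x2 \<noteq> x3" "x2 \<noteq> x4" "x3 \<noteq> x4" using assms by auto
  have colon: "{u. u + ?e \<in> qpw ?G (Suc t) ?m} = qpw ?G t ?m"
  proof (rule pw_colon)
    show "?e \<in> ?G" unfolding e by blast
    fix M u assume M: "set_mset M \<subseteq> ?G" "?e \<notin># M" "size M = Suc t" "mdvd (\<Sum>\<^sub># M) (u + ?e)"
    have gh: "set_mset M \<subseteq> {?g, ?h}" using M(1,2) unfolding e by auto
    have le: "lookup (\<Sum>\<^sub># M) i \<le> lookup u i + lookup ?e i" for i
      using M(4) by (simp add: mdvd_def lookup_add)
    obtain f where f: "f \<in># M" using M(3) by (metis multiset_nonemptyE size_empty nat.distinct(1))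
    show "u \<in> pw ?G t"
    proof (cases "?g \<in># M \<and> ?h \<in># M")
      case True
      \<comment> \<open>One copy of each heavy edge is traded for one copy of \<open>?e\<close>: two
        factors are lost, one is gained, and the excess pays for the division by
        \<open>?e\<close>.\<close>
      let ?N = "M - {#?g#} - {#?h#}"
      have "?g \<noteq> ?h"
      proof
        assume "?g = ?h"
        then have "lookup ?g x1 = lookup ?h x1" by simp
        then show False using d assms by (simp add: lookup_add lookup_single when_def)
      qed
      then have h: "?h \<in># M - {#?g#}" using True by (metis insert_DiffM insert_noteq_member)
      have s: "\<Sum>\<^sub># M = ?g + (?h + \<Sum>\<^sub># ?N)"
        using True h by (metis sum_mset.remove)
      have "size (M - {#?g#}) = t" using M(3) True by (simp add: size_Diff_singleton)
      then have "size (add_mset ?e ?N) = t" using size_Suc_Diff1[OF h] by simp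
      moreover have "set_mset (add_mset ?e ?N) \<subseteq> ?G"
        using M(1) e by (auto dest!: in_diffD)
      moreover have "mdvd (\<Sum>\<^sub># (add_mset ?e ?N)) u"
        unfolding mdvd_def
      proof
        fix i show "lookup (\<Sum>\<^sub># (add_mset ?e ?N)) i \<le> lookup u i"
          using le[of i] d assms(2,3) unfolding s
          by (auto simp: lookup_add lookup_single when_def split: if_splits)
      qed
      ultimately show ?thesis unfolding pw_def by blast
    next
      case False
      let ?N = "M - {#f#}"
      have s: "\<Sum>\<^sub># M = f + \<Sum>\<^sub># ?N" using f by (simp add: sum_mset.remove)
      have "set_mset ?N \<subseteq> ?G" "size ?N = t"
        using M f by (auto simp: size_Diff_singleton dest!: in_diffD)
      moreover have "mdvd (\<Sum>\<^sub># ?N) u"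
        unfolding mdvd_def
      proof
        fix i
        \<comment> \<open>Only one kind of heavy edge occurs. Dropping one copy compensates at its
          own vertex of \<open>?e\<close>, and the other vertex of \<open>?e\<close> is absent from
          the product.\<close>
        have 0: "lookup (\<Sum>\<^sub># M) i = 0" if "f = ?g \<and> i = x3 \<or> f = ?h \<and> i = x2"
        proof (rule sum_mset_lookup_0)
          fix k assume "k \<in># M"
          then have "k = f" using False f gh that by blast
          then show "lookup k i = 0"
            using that d by (auto simp: lookup_add lookup_single when_def)
        qed
        have "f = ?g \<or> f = ?h" using f gh by blast
        then show "lookup (\<Sum>\<^sub># ?N) i \<le> lookup u i"
          using 0 le[of i] d assms(2,3) unfolding s
          by (auto simp: lookup_add lookup_single when_def split: if_splits)
      qed
      ultimately show ?thesis unfolding pw_def by blast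
    qed
  qed
  have "filt ?V (Suc 1) (qpw ?G (Suc t) ?m)"
  proof (rule split_edge[OF _ _ _ _ colon])
    have "del ?G x2 = {?h}" using d assms by (auto simp: del_def lookup_add lookup_single when_def)
    moreover have "filt {x3, x4} 1 (qpw {?h} (Suc t) ?m)"
      by (rule filt_qpw_single) (use d keys_single_sub in \<open>auto simp: keys_add_nat card_insert_if\<close>)
    then have "filt (insert x1 {x3, x4}) (Suc 1) (qpw {?h} (Suc t) ?m)"
      by (rule filt_free) (use d in auto)
    moreover have "?V - {x2} = insert x1 {x3, x4}" using d by auto
    ultimately show "filt (?V - {x2}) (Suc 1) (qpw (del ?G x2) (Suc t) ?m)" by simp
    have "del ?G x3 = {?g}" using d assms by (auto simp: del_def lookup_add lookup_single when_def)
    moreover have "filt {x1, x2} 1 (qpw {?g} (Suc t) (?m + X x2))"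
      by (rule filt_qpw_single) (use d keys_single_sub in \<open>auto simp: keys_add_nat card_insert_if\<close>)
    then have "filt (insert x4 {x1, x2}) (Suc 1) (qpw {?g} (Suc t) (?m + X x2))"
      by (rule filt_free) (use d in auto)
    moreover have "?V - {x3} = insert x4 {x1, x2}" using d by auto
    ultimately show "filt (?V - {x3}) (Suc 1) (qpw (del ?G x3) (Suc t) (?m + X x2))" by simp
  qed (use Suc d in \<open>auto simp: lookup_add lookup_single when_def numeral_2_eq_2\<close>)
  then show ?case by (simp add: numeral_2_eq_2)
qed

section \<open>Paths with one heavy edge\<close>

lemma path_insert: "Suc l < s \<Longrightarrow> path w l s = insert (edge w l) (path w (Suc l) s)"
proof -
  assume "Suc l < s"
  then have "{j. l \<le> j \<and> Suc j < s} = insert l {j. Suc l \<le> j \<and> Suc j < s}" by auto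
  then show ?thesis by (simp add: path_def)
qed

lemma path_two: "path w l (l + 3) = {edge w l, edge w (Suc l)}"
  by (simp add: path_insert path_single eval_nat_numeral)

lemma path_three: "path w l (l + 4) = {edge w l, edge w (Suc l), edge w (l + 2)}"
  by (simp add: path_insert path_single eval_nat_numeral)

text \<open>The four paths with at most one further vertex on each side of the heavy edge, where
  stripping two unit edges at one end is impossible.\<close>

lemma path_depth_heavy_base:
  assumes pos: "\<And>j. l \<le> j \<Longrightarrow> Suc j < s \<Longrightarrow> w j > 0"
    and unit: "\<And>j. l \<le> j \<Longrightarrow> Suc j < s \<Longrightarrow> j \<noteq> i \<Longrightarrow> w j = 1"
    and l: "l = i \<or> Suc l = i" and s: "s = i + 2 \<or> s = i + 3"
  shows "path_depth w l s t 1"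
proof -
  have wi: "w i > 0" using pos[of i] l s by auto
  \<comment> \<open>The exponent \<open>c\<close> is 0 for the path itself and 1 after stripping a
    last vertex adjacent to \<open>Suc i\<close>.\<close>
  have right: "filt {l..<i + 2} 1 (qpw (path w l (i + 2)) t (single (Suc i) c))" if "Suc l = i" for c t
  proof -
    have "w l = 1" using unit[of l] that s by auto
    then have "path w l (i + 2) = {X l + X i, single i (w i) + single (Suc i) (w i)}"
      unfolding that[symmetric] using path_two[of w l] by (simp add: edge_def eval_nat_numeral)
    moreover have "{l..<i + 2} = {l, i, Suc i}" using that by auto
    ultimately show ?thesis using filt_heavy_leaf[of l i "Suc i" "w i" t c] that wi by auto
  qed
  have left: "path_depth w i (i + 3) t 1" if "s = i + 3"
  proof -
    have "w (Suc i) = 1" using unit[of "Suc i"] that l by auto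
    then have "path w i (i + 3) = {X (i + 2) + X (Suc i), single (Suc i) (w i) + single i (w i)}"
      unfolding path_two by (simp add: edge_def add.commute insert_commute)
    moreover have "{i..<i + 3} = {i + 2, Suc i, i}" by auto
    ultimately show ?thesis
      using filt_heavy_leaf[of "i + 2" "Suc i" i "w i" t 0] wi by (simp add: path_depth_def)
  qed
  consider "l = i" "s = i + 2" | "l = i" "s = i + 3" | "Suc l = i" "s = i + 2"
    | "Suc l = i" "s = i + 3" using l s by blast
  then show ?thesis
  proof cases
    case 1
    then show ?thesis using path_depth_single[of 1 w i t] by simp
  next
    case 2
    then show ?thesis using left by simp
  next
    case 3
    then show ?thesis using right[of t 0] by (simp add: path_depth_def)
  next
    case 4
    show ?thesis
    proof (induction t)
      case 0
      then show ?case by (rule path_depth_0)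
    next
      case (Suc t)
      have "filt {l..<Suc (Suc (Suc i))} (Suc 0) (qpw (path w l (Suc (Suc (Suc i)))) (Suc t) 0)"
      proof (rule path_strip_right)
        show "filt {l..<Suc (Suc (Suc i))} (Suc 0) (qpw (path w l (Suc (Suc (Suc i)))) t 0)"
          using Suc 4 by (simp add: path_depth_def numeral_3_eq_3)
        show "filt {l..<Suc i} 0 (qpw (path w l (Suc i)) (Suc t) 0)"
          using path_depth_single[of 0 w l "Suc t"] 4 by (simp add: path_depth_def)
        show "filt {l..<Suc (Suc i)} (Suc 0) (qpw (path w l (Suc (Suc i))) (Suc t) (0 + X (Suc i)))"
          using right[of "Suc t" 1] 4 by simp
      qed (use 4 pos unit in auto)
      then show ?case using 4 by (simp add: path_depth_def numeral_3_eq_3)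
    qed
  qed
qed

text \<open>Induction on the number of vertices plus \<open>t\<close>: unit edges are stripped in
  pairs from a side that has two of them, until the base case is reached.\<close>

lemma path_depth_heavy:
  assumes "\<And>j. l \<le> j \<Longrightarrow> Suc j < s \<Longrightarrow> w j > 0"
    and "\<And>j. l \<le> j \<Longrightarrow> Suc j < s \<Longrightarrow> j \<noteq> i \<Longrightarrow> w j = 1"
    and "t > 0" "l \<le> i" "i + 2 \<le> s" "3 * d + t + l \<le> s + 2 \<or> d \<le> 1"
  shows "path_depth w l s t d"
  using assms
proof (induction "s - l + t" arbitrary: s l t d rule: less_induct)
  case less
  note pos = less.prems(1) and unit = less.prems(2) and li = less.prems(4) and iu = less.prems(5)
    and d = less.prems(6)
  obtain t' where t: "t = Suc t'" using less.prems(3) gr0_implies_Suc by blast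
  have *: "path_depth w l' s' t'' d'"
    if "s' - l' + t'' < s - l + t" "l \<le> l'" "s' \<le> s" "l' \<le> i" "i + 2 \<le> s'"
      "t'' = 0 \<or> 3 * d' + t'' + l' \<le> s' + 2 \<or> d' \<le> 1" for l' s' t'' d'
    using less.hyps[of s' l' t'' d'] that pos unit path_depth_0 by (cases "t'' = 0") auto
  \<comment> \<open>Two unit edges to the right of the heavy one, two to the left, or at most one on
    each side.\<close>
  consider k where "s = k + 3" "i < k" | "l + 2 \<le> i" | "(l = i \<or> Suc l = i) \<and> (s = i + 2 \<or> s = i + 3)"
  proof -
    have "s = (s - 3) + 3 \<and> i < s - 3 \<or> l + 2 \<le> i \<or> (l = i \<or> Suc l = i) \<and> (s = i + 2 \<or> s = i + 3)"
      using li iu by arith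
    then show ?thesis using that by blast
  qed
  then show ?case
  proof cases
    case k: 1
    define e where "e = d - 1"
    have e: "e \<le> 0 \<or> 3 * e + t + l + 1 \<le> s" "d \<le> Suc e" using d by (auto simp: e_def)
    have "path_depth w l (k + 3) (Suc t') (Suc e)"
    proof (rule path_depth_right)
      show "path_depth w l (k + 3) t' (Suc e)"
        by (rule *) (use e k t li iu in auto)
      show "path_depth w l (k + 1) (Suc t') e"
        by (rule *) (use e k t li iu in auto)
      show "path_depth w l (k + 2) t' (Suc e)"
        by (rule *) (use e k t li iu in auto)
      show "path_depth w l k (Suc t') e"
      proof (cases "i + 2 \<le> k")
        case True
        show ?thesis by (rule *) (use True e k t li iu in auto)
      next
        \<comment> \<open>Here \<open>k = Suc i\<close>: the shorter path ends in vertex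
          \<open>i\<close> and has lost the heavy edge.\<close>
        case False
        show ?thesis
          by (rule path_depth_unit) (use False e k t li unit in auto)
      qed
    qed (use k li pos unit in auto)
    then show ?thesis using k t e(2) by (auto intro: path_depth_mono)
  next
    case l: 2
    define e where "e = d - 1"
    have e: "e \<le> 0 \<or> 3 * e + t + l + 1 \<le> s" "d \<le> Suc e" using d by (auto simp: e_def)
    have "path_depth w l s (Suc t') (Suc e)"
    proof (rule path_depth_left)
      show "path_depth w l s t' (Suc e)"
        by (rule *) (use e l t li iu in auto)
      show "path_depth w (l + 2) s (Suc t') e"
        by (rule *) (use e l t li iu in auto)
      show "path_depth w (l + 1) s t' (Suc e)"
        by (rule *) (use e l t li iu in auto)
      show "path_depth w (l + 3) s (Suc t') e"
      proof (cases "l + 3 \<le> i")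
        case True
        show ?thesis by (rule *) (use True e l t li iu in auto)
      next
        case False
        show ?thesis
          by (rule path_depth_unit) (use False e l t iu unit in auto)
      qed
    qed (use l iu pos unit in auto)
    then show ?thesis using t e(2) by (auto intro: path_depth_mono)
  next
    case 3
    then have "path_depth w l s t 1"
      using pos unit by (intro path_depth_heavy_base[of l s w i]) auto
    \<comment> \<open>At most four vertices and \<open>t > 0\<close> leave
      \<open>3 * d \<le> 5\<close>.\<close>
    moreover have "d \<le> 1" using 3 d t by arith
    ultimately show ?thesis by (rule path_depth_mono)
  qed
qed

text \<open>The bound is the one for the unweighted path.\<close>

lemma path_depth_heavy_1:
  assumes "\<And>j. l \<le> j \<Longrightarrow> Suc j < s \<Longrightarrow> w j > 0"
    and "\<And>j. l \<le> j \<Longrightarrow> Suc j < s \<Longrightarrow> j \<noteq> i \<Longrightarrow> w j = 1"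
    and "i = l + p" "s = i + 2 + q" "p mod 3 = 0 \<and> q mod 3 = 2 \<or> p mod 3 = 2 \<and> q mod 3 = 0"
    and "3 * d \<le> p + q + 4"
  shows "path_depth w l s 1 d"
  using assms
proof (induction "p + q" arbitrary: s l p q d rule: less_induct)
  case less
  note pos = less.prems(1) and unit = less.prems(2) and p = less.prems(3) and q = less.prems(4)
    and pq = less.prems(5) and d = less.prems(6)
  from pq show ?case
  proof
    assume m: "p mod 3 = 0 \<and> q mod 3 = 2"
    have q2: "q \<ge> 2" using m by presburger
    then have s: "s = (i + q - 1) + 3" using q by simp
    define e where "e = d - 1"
    have e: "3 * e \<le> p + q + 1" "d \<le> Suc e" using d by (auto simp: e_def)
    have "path_depth w l ((i + q - 1) + 3) (Suc 0) (Suc e)"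
    proof (rule path_depth_right)
      show "path_depth w l (i + q - 1 + 1) (Suc 0) e"
        by (rule path_depth_heavy[of _ _ _ i]) (use q2 p q e m pos unit in auto)
      \<comment> \<open>Removing three vertices preserves the residues down to \<open>q = 2\<close>.
        There the heavy edge is cut off, and the unweighted bound for \<open>p + 1\<close> vertices
        is exactly what is required.\<close>
      show "path_depth w l (i + q - 1) (Suc 0) e"
      proof (cases "q \<ge> 5")
        case True
        then obtain r where r: "q = r + 3" using le_Suc_ex[of 3 q] by (auto simp: add.commute)
        then show ?thesis
          using less.hyps[of p r l "i + q - 1" e] p q e m pos unit by simp
      next
        case False
        then have "q = 2" using m by presburger
        then show ?thesis
          by (intro path_depth_unit) (use p q e m unit in auto)
      qed
    qed (use q2 p q pos unit in \<open>auto intro: path_depth_0\<close>)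
    then show ?thesis using s e(2) by (auto intro: path_depth_mono)
  next
    assume m: "p mod 3 = 2 \<and> q mod 3 = 0"
    have p2: "p \<ge> 2" using m by presburger
    define e where "e = d - 1"
    have e: "3 * e \<le> p + q + 1" "d \<le> Suc e" using d by (auto simp: e_def)
    have "path_depth w l s (Suc 0) (Suc e)"
    proof (rule path_depth_left)
      show "path_depth w (l + 2) s (Suc 0) e"
        by (rule path_depth_heavy[of _ _ _ i]) (use p2 p q e m pos unit in auto)
      show "path_depth w (l + 3) s (Suc 0) e"
      proof (cases "p \<ge> 5")
        case True
        then show ?thesis
          using less.hyps[of "p - 3" q "l + 3" s e] p q e m pos unit le_mod_geq[of 3 p] by simp
      next
        case False
        then have "p = 2" using m by presburger
        then show ?thesis
          by (intro path_depth_unit) (use p q e m unit in auto)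
      qed
    qed (use p2 p q pos unit in \<open>auto intro: path_depth_0\<close>)
    then show ?thesis
      using e(2) by (auto intro: path_depth_mono)
  qed
qed

text \<open>With \<open>n = p + q + 2\<close> the bound is one better than
  \<open>path_depth_heavy\<close> gives for the square. Removing one end vertex and lowering the
  power leads to the residues of \<open>path_depth_heavy_1\<close>; removing three preserves those
  assumed here.\<close>

lemma path_depth_heavy_2:
  assumes "\<And>j. l \<le> j \<Longrightarrow> Suc j < s \<Longrightarrow> w j > 0"
    and "\<And>j. l \<le> j \<Longrightarrow> Suc j < s \<Longrightarrow> j \<noteq> i \<Longrightarrow> w j = 1"
    and "i = l + p" "s = i + 2 + q" "p mod 3 = 0" "q mod 3 = 0"
    and "3 * d \<le> p + q + 3"
  shows "path_depth w l s 2 d"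
  using assms
proof (induction "p + q" arbitrary: s l p q d rule: less_induct)
  case less
  note pos = less.prems(1) and unit = less.prems(2) and p = less.prems(3) and q = less.prems(4)
    and pm = less.prems(5) and qm = less.prems(6) and d = less.prems(7)
  have "q \<ge> 3 \<or> p \<ge> 3 \<or> p = 0 \<and> q = 0" using pm qm by presburger
  then consider "q \<ge> 3" | "p \<ge> 3" | "p = 0" "q = 0" by blast
  then show ?case
  proof cases
    case 1
    then obtain r where r: "q = r + 3" using le_Suc_ex[of 3 q] by (auto simp: add.commute)
    have q1: "(q - 1) mod 3 = 2" using 1 qm by (cases q) (auto simp: mod_Suc split: if_splits)
    have s: "s = (i + q - 1) + 3" using 1 q by simp
    define e where "e = d - 1"
    have e: "3 * e \<le> p + q" "d \<le> Suc e" using d by (auto simp: e_def)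
    have "path_depth w l ((i + q - 1) + 3) (Suc 1) (Suc e)"
    proof (rule path_depth_right)
      show "path_depth w l (i + q - 1 + 3) 1 (Suc e)"
        by (rule path_depth_heavy[of _ _ _ i]) (use 1 p q e pm qm pos unit in auto)
      show "path_depth w l (i + q - 1 + 1) (Suc 1) e"
        by (rule path_depth_heavy[of _ _ _ i]) (use 1 p q e pm qm pos unit in auto)
      show "path_depth w l (i + q - 1 + 2) 1 (Suc e)"
        by (rule path_depth_heavy_1[of _ _ _ i p "q - 1"])
          (use 1 p q e pm q1 pos unit in auto)
      show "path_depth w l (i + q - 1) (Suc 1) e"
        using less.hyps[of p r l "i + q - 1" e] r p q e pm qm pos unit
        by (simp add: numeral_2_eq_2)
    qed (use 1 p q pos unit in auto)
    then show ?thesis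
      using s e(2) by (auto intro: path_depth_mono simp: numeral_2_eq_2)
  next
    case 2
    have p1: "(p - 1) mod 3 = 2" using 2 pm by (cases p) (auto simp: mod_Suc split: if_splits)
    define e where "e = d - 1"
    have e: "3 * e \<le> p + q" "d \<le> Suc e" using d by (auto simp: e_def)
    have "path_depth w l s (Suc 1) (Suc e)"
    proof (rule path_depth_left)
      show "path_depth w l s 1 (Suc e)"
        by (rule path_depth_heavy[of _ _ _ i]) (use 2 p q e pm qm pos unit in auto)
      show "path_depth w (l + 2) s (Suc 1) e"
        by (rule path_depth_heavy[of _ _ _ i]) (use 2 p q e pm qm pos unit in auto)
      show "path_depth w (l + 1) s 1 (Suc e)"
        by (rule path_depth_heavy_1[of _ _ _ i "p - 1" q])
          (use 2 p q e p1 qm pos unit in auto)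
      show "path_depth w (l + 3) s (Suc 1) e"
        using less.hyps[of "p - 3" q "l + 3" s e] 2 p q e pm qm pos unit le_mod_geq[of 3 p]
        by (simp add: numeral_2_eq_2)
    qed (use 2 p q pos unit in auto)
    then show ?thesis
      using e(2) by (auto intro: path_depth_mono simp: numeral_2_eq_2)
  next
    case 3
    then show ?thesis using path_depth_single[of d w l 2] p q d by simp
  qed
qed

section \<open>Paths with two heavy edges\<close>

lemma filt_heavy_pair_path:
  assumes "w i \<ge> 2" "w (Suc i) = 1" "w (i + 2) \<ge> 2"
  shows "filt {i..<i + 4} 2 (qpw (path w i (i + 4)) t (single i c + single (i + 3) c'))"
proof -
  have "path w i (i + 4) = {single i (w i) + single (Suc i) (w i), X (Suc i) + X (i + 2),
      single (i + 2) (w (i + 2)) + single (i + 3) (w (i + 2))}"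
    unfolding path_three using assms(2) by (simp add: edge_def eval_nat_numeral)
  moreover have "{i..<i + 4} = {i, Suc i, i + 2, i + 3}" by auto
  ultimately show ?thesis
    using filt_heavy_pair[of i "Suc i" "i + 2" "i + 3" "w i" "w (i + 2)" t c c'] assms by simp
qed

text \<open>Stripping the unit edge on the right leaves the pair with a colon by its last vertex, or
  one heavy edge with a unit leaf. The colon by a power of \<open>i\<close> is kept for a unit edge
  on the left.\<close>

lemma filt_heavy_pair_right:
  assumes "w i \<ge> 2" "w (Suc i) = 1" "w (i + 2) \<ge> 2" "w (i + 3) = 1"
  shows "filt {i..<i + 5} 2 (qpw (path w i (i + 5)) t (single i c))"
proof (induction t)
  case 0
  then show ?case by (simp add: whole)
next
  case (Suc t)
  have "filt {i..<Suc (Suc (i + 3))} (Suc 1) (qpw (path w i (Suc (Suc (i + 3)))) (Suc t) (single i c))"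
  proof (rule path_strip_right)
    fix j assume "i \<le> j" "j \<le> i + 3"
    then consider "j = i" | "j = Suc i" | "j = i + 2" | "j = i + 3" by linarith
    then show "w j > 0" by cases (use assms in auto)
  next
    show "filt {i..<Suc (Suc (i + 3))} (Suc 1) (qpw (path w i (Suc (Suc (i + 3)))) t (single i c))"
      using Suc by (simp add: eval_nat_numeral)
    have "path w i (i + 3) = {X (i + 2) + X (Suc i), single (Suc i) (w i) + single i (w i)}"
      unfolding path_two using assms by (simp add: edge_def add.commute insert_commute)
    moreover have "{i..<i + 3} = {i + 2, Suc i, i}" by auto
    ultimately show "filt {i..<i + 3} 1 (qpw (path w i (i + 3)) (Suc t) (single i c))"
      using filt_heavy_leaf[of "i + 2" "Suc i" i "w i" "Suc t" c] assms by simp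
    show "filt {i..<Suc (i + 3)} (Suc 1)
        (qpw (path w i (Suc (i + 3))) (Suc t) (single i c + X (i + 3)))"
      using filt_heavy_pair_path[of w i "Suc t" c 1] assms by (simp add: eval_nat_numeral)
  qed (use assms in \<open>auto simp: lookup_single when_def\<close>)
  then show ?case by (simp add: eval_nat_numeral)
qed

lemma path_depth_heavy_pair_base:
  assumes w: "w i \<ge> 2" "w (i + 2) \<ge> 2"
    and unit: "\<And>j. l \<le> j \<Longrightarrow> Suc j < s \<Longrightarrow> j \<noteq> i \<Longrightarrow> j \<noteq> i + 2 \<Longrightarrow> w j = 1"
    and l: "l = i \<or> Suc l = i" and s: "s = i + 4 \<or> s = i + 5"
  shows "path_depth w l s t 2"
proof -
  have w1: "w (Suc i) = 1" using unit l s by auto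
  \<comment> \<open>Needed with \<open>c = 0\<close> when the path starts at the heavy edge, and
    with \<open>c = 1\<close> after stripping the leaf \<open>l\<close>, which leaves a colon by
    \<open>i\<close>.\<close>
  have core: "filt {i..<s} 2 (qpw (path w i s) t (single i c))" for t c
    using s
  proof
    assume "s = i + 4"
    then show ?thesis using filt_heavy_pair_path[of w i t c 0] w w1 by simp
  next
    assume "s = i + 5"
    then show ?thesis using filt_heavy_pair_right[of w i t c] w w1 unit[of "i + 3"] l by auto
  qed
  show ?thesis
  proof (cases "l = i")
    case True
    then show ?thesis using core[of t 0] by (simp add: path_depth_def)
  next
    case False
    then have l: "Suc l = i" using l by blast
    have pos: "w j > 0" if "l \<le> j" "Suc j < s" for j
      using w unit[of j] that by (cases "j = i \<or> j = i + 2") auto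
    show ?thesis
    proof (induction t)
      case 0
      then show ?case by (rule path_depth_0)
    next
      case (Suc t)
      have "filt {l..<s} (Suc 1) (qpw (path w l s) (Suc t) 0)"
      proof (rule path_strip_left)
        show "filt {l..<s} (Suc 1) (qpw (path w l s) t 0)"
          using Suc by (simp add: path_depth_def numeral_2_eq_2)
        have "path_depth w (Suc i) s (Suc t) 1"
          by (rule path_depth_heavy[of _ _ _ "i + 2"]) (use l s pos unit in \<open>force+\<close>)
        then show "filt {Suc (Suc l)..<s} 1 (qpw (path w (Suc (Suc l)) s) (Suc t) 0)"
          using l by (simp add: path_depth_def)
        show "filt {Suc l..<s} (Suc 1) (qpw (path w (Suc l) s) (Suc t) (0 + X (Suc l)))"
          using core[of "Suc t" 1] l by (simp add: numeral_2_eq_2)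
      qed (use l s pos unit in auto)
      then show ?case by (simp add: path_depth_def numeral_2_eq_2)
    qed
  qed
qed

text \<open>The induction of \<open>path_depth_heavy\<close> with lower bound 2. When a cut removes
  one heavy edge, the lower bound 1 for the other suffices, since two more vertices have been split
  off.\<close>

lemma path_depth_heavy_pair:
  assumes w: "w i \<ge> 2" "w (i + 2) \<ge> 2"
    and "\<And>j. l \<le> j \<Longrightarrow> Suc j < s \<Longrightarrow> j \<noteq> i \<Longrightarrow> j \<noteq> i + 2 \<Longrightarrow> w j = 1"
    and "t > 0" "l \<le> i" "i + 4 \<le> s" "3 * d + t + l \<le> s + 2 \<or> d \<le> 2"
  shows "path_depth w l s t d"
  using assms(3-)
proof (induction "s - l + t" arbitrary: s l t d rule: less_induct)
  case less
  note unit = less.prems(1) and li = less.prems(3) and iu = less.prems(4) and d = less.prems(5)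
  obtain t' where t: "t = Suc t'" using less.prems(2) gr0_implies_Suc by blast
  have pos: "w j > 0" if "l \<le> j" "Suc j < s" for j
    using w unit[of j] that by (cases "j = i \<or> j = i + 2") auto
  have *: "path_depth w l' s' t'' d'"
    if "s' - l' + t'' < s - l + t" "l \<le> l'" "s' \<le> s" "l' \<le> i" "i + 4 \<le> s'"
      "t'' = 0 \<or> 3 * d' + t'' + l' \<le> s' + 2 \<or> d' \<le> 2" for l' s' t'' d'
    using less.hyps[of s' l' t'' d'] that unit path_depth_0 by (cases "t'' = 0") auto
  consider k where "s = k + 3" "i + 2 < k" | "l + 2 \<le> i" | "(l = i \<or> Suc l = i) \<and> (s = i + 4 \<or> s = i + 5)"
  proof -
    have "s = (s - 3) + 3 \<and> i + 2 < s - 3 \<or> l + 2 \<le> i \<or> (l = i \<or> Suc l = i) \<and> (s = i + 4 \<or> s = i + 5)"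
      using li iu by arith
    then show ?thesis using that by blast
  qed
  then show ?case
  proof cases
    case k: 1
    define e where "e = d - 1"
    have e: "e \<le> 1 \<or> 3 * e + t + l + 1 \<le> s" "d \<le> Suc e" using d by (auto simp: e_def)
    have "path_depth w l (k + 3) (Suc t') (Suc e)"
    proof (rule path_depth_right)
      show "path_depth w l (k + 3) t' (Suc e)"
        by (rule *) (use e k t li iu in auto)
      show "path_depth w l (k + 1) (Suc t') e"
        by (rule *) (use e k t li iu in auto)
      show "path_depth w l (k + 2) t' (Suc e)"
        by (rule *) (use e k t li iu in auto)
      show "path_depth w l k (Suc t') e"
      proof (cases "i + 4 \<le> k")
        case True
        show ?thesis by (rule *) (use True e k t li iu in auto)
      next
        case False
        \<comment> \<open>The shorter path ends in vertex \<open>i + 2\<close>, so only the heavy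
          edge at \<open>i\<close> remains.\<close>
        then have "k = i + 3" using k by simp
        then show ?thesis
          by (intro path_depth_heavy[of _ _ _ i]) (use e k t li pos unit in auto)
      qed
    qed (use k li pos unit in auto)
    then show ?thesis using k t e(2) by (auto intro: path_depth_mono)
  next
    case l: 2
    define e where "e = d - 1"
    have e: "e \<le> 1 \<or> 3 * e + t + l + 1 \<le> s" "d \<le> Suc e" using d by (auto simp: e_def)
    have "path_depth w l s (Suc t') (Suc e)"
    proof (rule path_depth_left)
      show "path_depth w l s t' (Suc e)"
        by (rule *) (use e l t li iu in auto)
      show "path_depth w (l + 2) s (Suc t') e"
        by (rule *) (use e l t li iu in auto)
      show "path_depth w (l + 1) s t' (Suc e)"
        by (rule *) (use e l t li iu in auto)
      show "path_depth w (l + 3) s (Suc t') e"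
      proof (cases "l + 3 \<le> i")
        case True
        show ?thesis by (rule *) (use True e l t li iu in auto)
      next
        case False
        \<comment> \<open>The shorter path starts in vertex \<open>i + 1\<close>, so only the heavy
          edge at \<open>i + 2\<close> remains.\<close>
        then have "i = l + 2" using l by simp
        then show ?thesis
          by (intro path_depth_heavy[of _ _ _ "i + 2"]) (use e t iu pos unit in auto)
      qed
    qed (use l iu pos unit in auto)
    then show ?thesis using t e(2) by (auto intro: path_depth_mono)
  next
    case 3
    then have "path_depth w l s t 2"
      using w unit by (intro path_depth_heavy_pair_base[of w i]) auto
    moreover have "d \<le> 2" using 3 d t by arith
    ultimately show ?thesis by (rule path_depth_mono)
  qed
qed

subsection \<open>The powers of the edge ideal\<close>

lemma pw_add: "u \<in> pw G s \<Longrightarrow> v \<in> pw G t \<Longrightarrow> u + v \<in> pw G (s + t)"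
proof -
  assume "u \<in> pw G s" "v \<in> pw G t"
  then obtain M N where "set_mset M \<subseteq> G" "size M = s" "mdvd (\<Sum>\<^sub># M) u"
    "set_mset N \<subseteq> G" "size N = t" "mdvd (\<Sum>\<^sub># N) v" by (auto simp: pw_def)
  then have "set_mset (M + N) \<subseteq> G \<and> size (M + N) = s + t \<and> mdvd (\<Sum>\<^sub># (M + N)) (u + v)"
    by (auto simp: mdvd_def lookup_add intro: add_mono)
  then show ?thesis unfolding pw_def by blast
qed

lemma pw_SucE:
  assumes "u \<in> pw G (Suc t)"
  obtains g v where "g \<in> G" "v \<in> pw G t" "u = g + v"
proof -
  obtain M where M: "set_mset M \<subseteq> G" "size M = Suc t" "mdvd (\<Sum>\<^sub># M) u"
    using assms by (auto simp: pw_def)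
  obtain g where g: "g \<in># M" using M(2) by (metis multiset_nonemptyE size_empty nat.distinct(1))
  obtain v where v: "u = \<Sum>\<^sub># M + v" using M(3) mdvd_iff by blast
  have "u = g + (\<Sum>\<^sub># (M - {#g#}) + v)" using v g by (simp add: sum_mset.remove add.assoc)
  moreover have "set_mset (M - {#g#}) \<subseteq> G" "size (M - {#g#}) = t"
    using M g by (auto simp: size_Diff_singleton dest: in_diffD)
  then have "\<Sum>\<^sub># (M - {#g#}) + v \<in> pw G t" by (auto simp: pw_def mdvd_iff)
  ultimately show ?thesis using that M(1) g by blast
qed

lemma gen_pw: "g \<in> G \<Longrightarrow> g \<in> pw G (Suc 0)"
proof -
  assume "g \<in> G"
  then have "set_mset {#g#} \<subseteq> G \<and> size {#g#} = Suc 0 \<and> mdvd (\<Sum>\<^sub># {#g#}) g" by (simp add: mdvd_def)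
  then show ?thesis unfolding pw_def by blast
qed

lemma zero_notin_pw:
  assumes "0 \<notin> G"
  shows "0 \<notin> pw G (Suc t)"
proof
  assume "0 \<in> pw G (Suc t)"
  then obtain g v where g: "g \<in> G" "0 = g + v" by (blast elim: pw_SucE)
  have "lookup g i = 0" for i using arg_cong[OF g(2), of "\<lambda>u. lookup u i"] by (simp add: lookup_add)
  then have "g = 0" by (intro poly_mapping_eqI) simp
  then show False using g assms by simp
qed

lemma ideal_gen_monomials:
  assumes G: "\<And>g. g \<in> G \<Longrightarrow> keys g \<subseteq> {1..n}"
  shows "ideal_gen n ((\<lambda>g. single g (1::'a::field)) ` G) = MI n (pw G (Suc 0))"
proof (rule antisym)
  let ?I = "ideal_gen n ((\<lambda>g. single g (1::'a)) ` G)"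
  show "?I \<subseteq> MI n (pw G (Suc 0))"
    by (intro ideal_gen_least is_ideal_MI upset_pw) (use G gen_pw in \<open>auto simp: MI_def\<close>)
  have I: "is_ideal n ?I" by (rule is_ideal_gen) (use G in auto)
  show "MI n (pw G (Suc 0)) \<subseteq> ?I"
  proof
    fix p :: "'a mpoly" assume p: "p \<in> MI n (pw G (Suc 0))"
    have "single u (lookup p u) \<in> ?I" if u: "u \<in> keys p" for u
    proof -
      have "u \<in> pw G (Suc 0)" using p u by (auto simp: MI_def)
      then obtain g v where gv: "g \<in> G" "u = g + v" by (blast elim: pw_SucE)
      have "keys u \<subseteq> {1..n}" using p u unfolding MI_def PR_def by blast
      then have kv: "keys v \<subseteq> {1..n}" using gv by (simp add: keys_add_nat)
      have "single v (lookup p u) * single g 1 \<in> ?I"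
        by (rule ideal_mult[OF I]) (use kv gv in \<open>auto intro: ideal_gen.gen\<close>)
      then show ?thesis using gv by (simp add: mult_single add.commute)
    qed
    then show "p \<in> ?I" by (subst poly_expand) (intro ideal_sum[OF I])
  qed
qed

text \<open>Supports of products give one inclusion; for the other, each term splits off a generator
  by \<open>pw_SucE\<close>.\<close>

lemma ideal_pow_monomials:
  assumes G: "\<And>g. g \<in> G \<Longrightarrow> keys g \<subseteq> {1..n}"
  shows "ideal_pow n (ideal_gen n ((\<lambda>g. single g (1::'a::field)) ` G)) t = MI n (pw G t)"
proof (induction t)
  case 0
  have "pw G 0 = UNIV" by (auto simp: pw_def mdvd_def)
  then show ?case by (auto simp: MI_def)
next
  case (Suc t)
  let ?P = "{a * b | a b. a \<in> (MI n (pw G t) :: 'a mpoly set) \<and> b \<in> MI n (pw G (Suc 0))}"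
  have "a * b \<in> MI n (pw G (Suc t))" if "a \<in> MI n (pw G t)" "b \<in> MI n (pw G (Suc 0))"
    for a b :: "'a mpoly"
  proof -
    have "keys (a * b) \<subseteq> pw G (Suc t)"
    proof
      fix m assume "m \<in> keys (a * b)"
      then obtain u v where "m = u + v" "u \<in> keys a" "v \<in> keys b" using keys_mult[of a b] by blast
      then show "m \<in> pw G (Suc t)" using pw_add[of u G t v "Suc 0"] that by (auto simp: MI_def)
    qed
    then show ?thesis using that by (simp add: MI_def)
  qed
  then have P: "?P \<subseteq> MI n (pw G (Suc t))" by blast
  then have PR: "?P \<subseteq> PR n" by (auto simp: MI_def)
  note I = is_ideal_gen[OF this]
  have "MI n (pw G (Suc t)) \<subseteq> ideal_gen n ?P"
  proof
    fix p :: "'a mpoly" assume p: "p \<in> MI n (pw G (Suc t))"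
    have "single u (lookup p u) \<in> ideal_gen n ?P" if u: "u \<in> keys p" for u
    proof -
      have "u \<in> pw G (Suc t)" using p u by (auto simp: MI_def)
      then obtain g v where gv: "g \<in> G" "v \<in> pw G t" "u = g + v" by (blast elim: pw_SucE)
      have "keys u \<subseteq> {1..n}" using p u unfolding MI_def PR_def by blast
      then have kv: "keys v \<subseteq> {1..n}" using gv by (simp add: keys_add_nat)
      have "single v (lookup p u) \<in> MI n (pw G t)" "single g 1 \<in> (MI n (pw G (Suc 0)) :: 'a mpoly set)"
        using kv gv G gen_pw[OF gv(1)] by (auto simp: MI_def)
      then have "single v (lookup p u) * single g 1 \<in> ideal_gen n ?P"
        by (intro ideal_gen.gen) blast
      then show ?thesis using gv by (simp add: mult_single add.commute)
    qed
    then show "p \<in> ideal_gen n ?P" by (subst poly_expand) (intro ideal_sum[OF I])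
  qed
  moreover have "ideal_gen n ?P \<subseteq> MI n (pw G (Suc t))"
    by (intro ideal_gen_least is_ideal_MI upset_pw P)
  ultimately show ?case using Suc ideal_gen_monomials[OF G, where 'a='a] by simp
qed

lemma path_edge_ideal_gen:
  "path_edge_ideal n w = ideal_gen n ((\<lambda>g. single g (1::'a::field)) ` path w 1 (Suc n))"
proof -
  have "{1..n - 1} = {j. 1 \<le> j \<and> Suc j < Suc n}" by auto
  then show ?thesis
    by (simp add: path_edge_ideal_def path_def image_image Var_power mult_single edge_def)
qed

text \<open>Positive weights keep the exponent 0 out of the generators, so the power is a proper
  ideal, as \<open>depth_filt\<close> requires.\<close>

lemma depth_path:
  assumes d: "path_depth w 1 (Suc n) t d" and w: "\<forall>j\<in>{1..n-1}. w j > 0" and t: "t \<ge> 2"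
  shows "enat d \<le> depth n (ideal_pow n (path_edge_ideal n w :: 'a::field mpoly set) t)"
proof -
  let ?G = "path w 1 (Suc n)"
  have "keys g \<subseteq> {1..n}" if g: "g \<in> ?G" for g
  proof -
    obtain j where "1 \<le> j" "Suc j < Suc n" "g = edge w j" using g by (auto simp: path_def)
    then show ?thesis using keys_edge[of w j] by auto
  qed
  note I = ideal_pow_monomials[OF this]
  have "0 \<notin> ?G"
  proof
    assume "0 \<in> ?G"
    then obtain j where j: "1 \<le> j" "j < n" "0 = edge w j" by (auto simp: path_def)
    then have "w j = 0" using lookup_edge[of w j j] by simp
    then show False using w j by force
  qed
  then have "0 \<notin> pw ?G t" using zero_notin_pw t by (metis Suc_le_D numeral_2_eq_2)
  moreover have "qpw ?G t 0 = pw ?G t" by (simp add: qpw_def)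
  moreover have "{1..<Suc n} = {1..n}" by auto
  ultimately have "enat d \<le> depth n (MI n (pw ?G t) :: 'a mpoly set)"
    using d by (intro depth_filt upset_pw) (auto simp: path_depth_def)
  then show ?thesis by (simp add: path_edge_ideal_gen I)
qed

theorem theorem4p18:
  fixes n i t :: nat and w :: "nat \<Rightarrow> nat" and I :: "'a::field mpoly set"
  assumes n5: "n \<ge> 5"
    and wpos: "\<forall>j\<in>{1..n-1}. w j > 0"
    and I_def: "I = path_edge_ideal n w"
    and closed: "integrally_closed n I"
    and i_range: "i \<in> {1..n-3}"
    and w_gt: "w i > w (i + 2)"
    and w_one: "\<forall>j\<in>{1..n-1}. j \<noteq> i \<and> j \<noteq> i + 2 \<longrightarrow> w j = 1"
    and t2: "t \<ge> 2"
  shows "(w (i + 2) = 1 \<longrightarrow>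
           (if t = 2 \<and> i mod 3 = 1 \<and> n mod 3 = 2
            then depth n (ideal_pow n I t) \<ge> enat (nat \<lceil>(real n - 1) / 3\<rceil>)
            else depth n (ideal_pow n I t) \<ge> enat (nat (max \<lceil>(real n - real t) / 3\<rceil> 1))))
       \<and> (w (i + 2) > 1 \<longrightarrow>
           depth n (ideal_pow n I t) \<ge> enat (nat (max \<lceil>(real n - real t) / 3\<rceil> 2)))"
proof -
  have pos: "w j > 0" if "1 \<le> j" "Suc j < Suc n" for j using wpos that by auto
  have one: "w j = 1" if "1 \<le> j" "Suc j < Suc n" "j \<noteq> i" "j \<noteq> i + 2" for j using w_one that by auto
  have i: "1 \<le> i" "i + 3 \<le> n" using i_range n5 by auto
  have dep: "depth n (ideal_pow n I t) \<ge> enat d" if "path_depth w 1 (Suc n) t d" for d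
    unfolding I_def by (rule depth_path[OF that wpos t2])
  \<comment> \<open>The ceiling in the linear form of the path lemmas, with \<open>l = 1\<close> and
    \<open>s = Suc n\<close>.\<close>
  have ceil: "3 * d + t + 1 \<le> Suc n + 2 \<or> d \<le> nat c" if "d = nat (max \<lceil>(real n - real t) / 3\<rceil> c)" for d c
  proof (cases "\<lceil>(real n - real t) / 3\<rceil> \<le> c")
    case True
    then show ?thesis using that by simp
  next
    case False
    then have "d \<le> 0 \<or> int d = \<lceil>(real n - real t) / 3\<rceil>" using that by auto
    then show ?thesis
    proof
      assume "int d = \<lceil>(real n - real t) / 3\<rceil>"
      then have "real d < (real n - real t) / 3 + 1" by linarith
      then have "real (3 * d + t) < real (n + 3)" by (simp add: field_simps)
      then have "3 * d + t + 1 \<le> Suc n + 2" by linarith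
      then show ?thesis by simp
    qed simp
  qed
  have "depth n (ideal_pow n I t) \<ge> enat (nat \<lceil>(real n - 1) / 3\<rceil>)"
    if w2: "w (i + 2) = 1" and t: "t = 2" and m: "i mod 3 = 1" "n mod 3 = 2"
  proof (rule dep)
    let ?d = "nat \<lceil>(real n - 1) / 3\<rceil>"
    have "0 \<le> (real n - 1) / 3" using n5 by simp
    then have "int ?d = \<lceil>(real n - 1) / 3\<rceil>" by simp
    then have "real ?d < (real n - 1) / 3 + 1" by linarith
    then have "real (3 * ?d) < real (n + 2)" by (simp add: field_simps)
    then have d: "3 * ?d \<le> n + 1" by linarith
    obtain k where k: "i = 3 * k + 1" using m(1) by (metis mult_div_mod_eq)
    obtain r where r: "n = 3 * r + 2" using m(2) by (metis mult_div_mod_eq)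
    \<comment> \<open>There are \<open>i - 1 = 3 * k\<close> vertices before the heavy edge and
      \<open>n - i - 1\<close> after it; both numbers are divisible by 3, as
      \<open>path_depth_heavy_2\<close> asks.\<close>
    have q: "n - i - 1 = 3 * (r - k)" using k r by simp
    have one': "w j = 1" if "1 \<le> j" "Suc j < Suc n" "j \<noteq> i" for j
      using one[OF that] w2 by (cases "j = i + 2") auto
    show "path_depth w 1 (Suc n) t ?d"
      unfolding t
      by (rule path_depth_heavy_2[where p="i - 1" and q="n - i - 1" and i=i])
        (use pos one' i d k q in auto)
  qed
  moreover have "depth n (ideal_pow n I t) \<ge> enat (nat (max \<lceil>(real n - real t) / 3\<rceil> 1))"
    if w2: "w (i + 2) = 1"
  proof (rule dep, rule path_depth_heavy[where i=i])
    show "w j = 1" if "1 \<le> j" "Suc j < Suc n" "j \<noteq> i" for j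
      using one[OF that] w2 by (cases "j = i + 2") auto
  qed (use pos i t2 ceil[OF refl, of 1] in auto)
  \<comment> \<open>From \<open>w i > w (i + 2) > 1\<close> both weights are at least 2, so the
    edges at \<open>i\<close> and \<open>i + 2\<close> form a heavy pair.\<close>
  moreover have "depth n (ideal_pow n I t) \<ge> enat (nat (max \<lceil>(real n - real t) / 3\<rceil> 2))"
    if w2: "w (i + 2) > 1"
    by (rule dep, rule path_depth_heavy_pair[where i=i])
      (use one i t2 w2 w_gt ceil[OF refl, of 2] in auto)
  ultimately show ?thesis by auto
qed

end
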